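(* There exists an $\aleph_1$-free superdecomposable abelian group of cardinality $\aleph_1$.
   Context: An abelian group is $\aleph_1$-free if all its countable subgroups are free abelian. An abelian group is superdecomposable if every nonzero direct summand of it decomposes into a direct sum of two nonzero subgroups. The statement is a theorem of ZFC (no continuum hypothesis is assumed). *)

theory Defs
  imports "HOL-Algebra.Free_Abelian_Groups" "HOL-Library.Countable_Set"
begin

unbundle cardinal_syntax

(* Abelian groups are HOL-Algebra commutative groups and hence written multiplicatively:
   the zero subgroup is {\<one>}, and a subgroup H of G, as a group, is G\<lparr>carrier := H\<rparr>. *)

(* Taking S to be a set of elements of the carrier type is no restriction:
   a basis of G is itself a subset of the carrier. *)
definition free_abelian :: "('a, 'b) monoid_scheme \<Rightarrow> bool" where
  "free_abelian G \<longleftrightarrow> comm_group G \<and> (\<exists>S :: 'a set. G \<cong> free_Abelian_group S)"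

definition aleph1_free :: "('a, 'b) monoid_scheme \<Rightarrow> bool" where
  "aleph1_free G \<longleftrightarrow>
     comm_group G \<and> (\<forall>H. subgroup H G \<and> countable H \<longrightarrow> free_abelian (G\<lparr>carrier := H\<rparr>))"

definition internal_direct_sum :: "('a, 'b) monoid_scheme \<Rightarrow> 'a set \<Rightarrow> 'a set \<Rightarrow> bool" where
  "internal_direct_sum G A B \<longleftrightarrow>
     subgroup A G \<and> subgroup B G \<and> A \<inter> B = {\<one>\<^bsub>G\<^esub>} \<and> A <#>\<^bsub>G\<^esub> B = carrier G"

definition direct_summand :: "'a set \<Rightarrow> ('a, 'b) monoid_scheme \<Rightarrow> bool" where
  "direct_summand H G \<longleftrightarrow> (\<exists>K. internal_direct_sum G H K)"

definition decomposable :: "('a, 'b) monoid_scheme \<Rightarrow> bool" where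
  "decomposable G \<longleftrightarrow>
     (\<exists>A B. internal_direct_sum G A B \<and> A \<noteq> {\<one>\<^bsub>G\<^esub>} \<and> B \<noteq> {\<one>\<^bsub>G\<^esub>})"

definition superdecomposable :: "('a, 'b) monoid_scheme \<Rightarrow> bool" where
  "superdecomposable G \<longleftrightarrow>
     comm_group G \<and>
     (\<forall>H. direct_summand H G \<and> H \<noteq> {\<one>\<^bsub>G\<^esub>} \<longrightarrow> decomposable (G\<lparr>carrier := H\<rparr>))"

end

(* Let R be the ring of locally constant integer functions on the Cantor space of subsets of nat,
   and let B be the free R-module on the nodes of countably many binary trees. To each of aleph_1
   branches v adjoin y_v = sum_j q_j (e_{v|j} + [v turns right at j] b_v) together with all its
   tails divided by q_j = p_{v|0} ... p_{v|j-1}, where distinct nodes have distinct primes and every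
   b in B occurs as b_v for uncountably many v. Pontryagin's criterion makes the result G aleph_1-free.
   Let f be an endomorphism of G. The types of distinct branches are incomparable, so f y_v lies in
   Q R y_v modulo a fixed countable subgroup; by pigeonhole m f y_v = r y_v + g with the same m, r, g
   for uncountably many v with b_v = b. For two of these that split at the node t, subtraction shows
   that p_t divides (m f - r) b; this holds for infinitely many t, so m f b = r b. Hence f is
   multiplication by an element of R. Every nonzero idempotent of R splits, and so does every
   nonzero direct summand of G. *)

theory Submission
  imports Defs "HOL-Library.Function_Algebras" "HOL-Library.Nat_Bijection" "HOL-Computational_Algebra.Primes"
begin

text \<open>Endomorphisms are not excluded one by one along an enumeration. A single counting
  argument treats them all: uncountably many branches carry the same b, but only countably many
  triples (m, r, g) are available. This is why R and B must be countable while the set of branches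
  is not. The two summands in y_v have different tasks. Once v has left finitely many other
  branches, e_{v|j} is a coordinate that only v reaches; it keeps the denominators over a finite
  support bounded, and hence countable subgroups free. The summand b_v appears on right turns only,
  so it is exactly what two branches splitting at j do not share, and their difference exposes b
  modulo p_t. Primes belong to nodes, not to levels. Two branches thus share only finitely many
  primes, which makes their types incomparable; yet the prime at the splitting node is common to
  both, so it divides everything in the difference except b. R is taken for its idempotents: they
  are the clopen sets, and these have no atoms. The infinite series never occurs as such. y_v is a
  formal coordinate over the rationals, and its series enters through partial sums only.\<close>

subsection \<open>A criterion for countable groups to be free\<close>

lemma hom_rat_int_pow:
  fixes c :: "'a \<Rightarrow> rat"
  assumes "group G"
    and add: "\<And>x y. x \<in> carrier G \<Longrightarrow> y \<in> carrier G \<Longrightarrow> c (x \<otimes>\<^bsub>G\<^esub> y) = c x + c y"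
    and x: "x \<in> carrier G"
  shows "c (x [^]\<^bsub>G\<^esub> (k::int)) = of_int k * c x"
proof -
  interpret group G by fact
  have one: "c \<one>\<^bsub>G\<^esub> = 0"
    using add[of "\<one>\<^bsub>G\<^esub>" "\<one>\<^bsub>G\<^esub>"] by simp
  have nat: "c (x [^]\<^bsub>G\<^esub> (n::nat)) = of_nat n * c x" for n
    by (induction n) (auto simp: one add x algebra_simps)
  have inv: "c (inv\<^bsub>G\<^esub> y) = - c y" if "y \<in> carrier G" for y
    using add[of y "inv\<^bsub>G\<^esub> y"] that one by simp
  show ?thesis
  proof (cases "k \<ge> 0")
    case True
    then obtain n where "k = int n" using nonneg_int_cases by blast
    then show ?thesis by (simp add: int_pow_int nat)
  next
    case False
    then obtain n where "k = - int n" by (metis int_cases2 nle_le of_nat_0_le_iff)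
    then show ?thesis using x by (simp add: int_pow_neg_int inv nat)
  qed
qed

text \<open>Bounded denominators give a least positive element, unless there is none at all;
  division with remainder shows that it generates.\<close>

lemma cyclic_rat_generator:
  fixes L :: "rat set"
  assumes sub: "\<And>x y k. x \<in> L \<Longrightarrow> y \<in> L \<Longrightarrow> x - of_int k * y \<in> L" and ne: "L \<noteq> {}"
    and D: "D > (0::nat)" "\<And>x. x \<in> L \<Longrightarrow> of_nat D * x \<in> \<int>"
  shows "\<exists>g\<in>L. \<forall>x\<in>L. \<exists>k::int. x = of_int k * g"
proof (cases "\<exists>x\<in>L. x > 0")
  case False
  obtain z where z: "z \<in> L" using ne by blast
  have 0: "0 \<in> L" using sub[OF z z, of 1] by simp
  have "x = 0" if "x \<in> L" for x
    using sub[OF 0 that, of 1] that False by (simp, metis linorder_neqE_linordered_idom neg_0_less_iff_less)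
  then show ?thesis using 0 by (metis mult_zero_right)
next
  case True
  define M where "M = {n::nat. n > 0 \<and> of_nat n / of_nat D \<in> L}"
  have conv: "\<exists>n\<in>M. x = of_nat n / of_nat D" if xL: "x \<in> L" "x > 0" for x
  proof -
    obtain m :: int where m: "of_nat D * x = of_int m" using D(2)[OF xL(1)] Ints_cases by blast
    have "(of_int m :: rat) > 0" using m D(1) xL(2) by (metis mult_pos_pos of_nat_0_less_iff)
    then have "m > 0" by simp
    then obtain n where n: "m = int n" "n > 0" by (metis pos_int_cases)
    have "x = of_nat n / of_nat D" using m n D(1) by (simp add: field_simps)
    then show ?thesis using xL n by (auto simp: M_def)
  qed
  have "M \<noteq> {}" using True conv by blast
  define n where "n = (LEAST n. n \<in> M)"
  have nM: "n \<in> M" unfolding n_def using \<open>M \<noteq> {}\<close> by (metis LeastI ex_in_conv)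
  define g where "g = (of_nat n / of_nat D :: rat)"
  have g: "g \<in> L" "g > 0" using nM D(1) by (auto simp: M_def g_def)
  have "x = of_int \<lfloor>x / g\<rfloor> * g" if x: "x \<in> L" for x
  proof -
    define r where "r = x - of_int \<lfloor>x / g\<rfloor> * g"
    have r: "r \<in> L" using sub[OF x g(1)] r_def by simp
    have "of_int \<lfloor>x / g\<rfloor> \<le> x / g" "x / g < of_int \<lfloor>x / g\<rfloor> + 1" by linarith+
    then have r0: "r \<ge> 0" "r < g"
      unfolding r_def pos_le_divide_eq[OF g(2)] pos_divide_less_eq[OF g(2)] by (simp_all add: algebra_simps)
    have "\<not> r > 0"
    proof
      assume "r > 0"
      then obtain n' where n': "n' \<in> M" "r = of_nat n' / of_nat D" using conv r by blast
      have "n' < n" using n'(2) r0(2) D(1) by (simp add: g_def divide_less_cancel)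
      then show False using n'(1) not_less_Least unfolding n_def by blast
    qed
    then show ?thesis using r0(1) r_def by simp
  qed
  then show ?thesis using g(1) by blast
qed

text \<open>The boundedness assumption makes the leading coordinates at each level a cyclic group; elements
  whose leading coordinates generate these groups form a basis.\<close>

lemma free_abelian_if_rat_coordinates:
  fixes c :: "nat \<Rightarrow> 'a \<Rightarrow> rat" and G :: "'a monoid" (structure)
  assumes G: "comm_group G"
    and add: "\<And>n x y. x \<in> carrier G \<Longrightarrow> y \<in> carrier G \<Longrightarrow> c n (x \<otimes>\<^bsub>G\<^esub> y) = c n x + c n y"
    and fin: "\<And>x. x \<in> carrier G \<Longrightarrow> finite {n. c n x \<noteq> 0}"
    and inj: "\<And>x. x \<in> carrier G \<Longrightarrow> (\<And>n. c n x = 0) \<Longrightarrow> x = \<one>\<^bsub>G\<^esub>"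
    and bounded: "\<And>n. \<exists>D::nat. D > 0 \<and>
       (\<forall>x\<in>carrier G. (\<forall>m>n. c m x = 0) \<longrightarrow> of_nat D * c n x \<in> \<int>)"
  shows "free_abelian G"
proof -
  interpret comm_group G by fact
  define F where "F = (\<lambda>n. {x\<in>carrier G. \<forall>m\<ge>n. c m x = 0})"
  have pow: "c n (x [^] (k::int)) = of_int k * c n x" if "x \<in> carrier G" for n x k
    by (rule hom_rat_int_pow[OF is_group]) (use add that in auto)
  have one: "c n \<one> = 0" for n using pow[of \<one> n 0] by simp
  have F_pow: "x \<otimes> y [^] (k::int) \<in> F n" if "x \<in> F n" "y \<in> F n" for x y k n
    using that by (auto simp: F_def add pow)
  have "\<exists>g\<in>F (Suc n). \<forall>x\<in>F (Suc n). \<exists>k::int. c n x = of_int k * c n g" for n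
  proof -
    obtain D :: nat where D: "D > 0" "\<forall>x\<in>carrier G. (\<forall>m>n. c m x = 0) \<longrightarrow> of_nat D * c n x \<in> \<int>"
      using bounded by blast
    have "\<exists>g\<in>c n ` F (Suc n). \<forall>x\<in>c n ` F (Suc n). \<exists>k::int. x = of_int k * g"
    proof (rule cyclic_rat_generator[OF _ _ D(1)])
      fix x y and k :: int assume "x \<in> c n ` F (Suc n)" "y \<in> c n ` F (Suc n)"
      then obtain a b where ab: "a \<in> F (Suc n)" "b \<in> F (Suc n)" "x = c n a" "y = c n b" by auto
      have "x - of_int k * y = c n (a \<otimes> b [^] (-k))"
        using ab by (simp add: F_def add pow del: int_pow_neg)
      then show "x - of_int k * y \<in> c n ` F (Suc n)" using F_pow[OF ab(1,2)] by blast
    next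
      have "\<one> \<in> F (Suc n)" by (simp add: F_def one)
      then show "c n ` F (Suc n) \<noteq> {}" by blast
    qed (use D(2) in \<open>auto simp: F_def Suc_le_eq\<close>)
    then show ?thesis by auto
  qed
  then obtain b where bF: "\<And>n. b n \<in> F (Suc n)"
    and bgen: "\<And>n x. x \<in> F (Suc n) \<Longrightarrow> \<exists>k::int. c n x = of_int k * c n (b n)"
    by metis
  \<comment> \<open>Outside T there is no leading coordinate to account for: every element of
    \<open>F (Suc n)\<close> already lies in \<open>F n\<close>.\<close>
  define T where "T = {n. c n (b n) \<noteq> 0}"
  have bcar: "b n \<in> carrier G" for n using bF by (auto simp: F_def)
  have bzero: "c m (b n) = 0" if "m > n" for m n using bF[of n] that by (auto simp: F_def)
  have b_inj: "inj_on b T"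
  proof (rule inj_onI)
    fix m n assume "m \<in> T" "n \<in> T" "b m = b n"
    then show "m = n" using bzero[of m n] bzero[of n m] by (auto simp: T_def) (metis linorder_neqE_nat)
  qed
  define S where "S = b ` T"
  have ScG: "S \<subseteq> carrier G" using bcar S_def by auto
  let ?A = "free_Abelian_group S"
  obtain h where h: "h \<in> hom ?A G" "\<And>x. x \<in> S \<Longrightarrow> h (frag_of x) = x"
    using free_Abelian_group_universal[of "\<lambda>x. x" S] ScG by auto
  interpret h: group_hom ?A G h
    using h(1) by (simp add: group_hom_def group_hom_axioms_def is_group)
  have lin: "c m (h x) = (\<Sum>s\<in>Poly_Mapping.keys x. of_int (Poly_Mapping.lookup x s) * c m s)"
    if x: "Poly_Mapping.keys x \<subseteq> S" for x m
    using x
  proof (rule free_Abelian_group_induct)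
    show "c m (h 0) = (\<Sum>s\<in>Poly_Mapping.keys 0. of_int (Poly_Mapping.lookup 0 s) * c m s)"
      using h.hom_one one by simp
  next
    fix a assume "a \<in> S"
    then show "c m (h (frag_of a)) =
      (\<Sum>s\<in>Poly_Mapping.keys (frag_of a). of_int (Poly_Mapping.lookup (frag_of a) s) * c m s)"
      by (simp add: h(2))
  next
    fix x y :: "'a \<Rightarrow>\<^sub>0 int"
    assume xS: "Poly_Mapping.keys x \<subseteq> S" and yS: "Poly_Mapping.keys y \<subseteq> S"
      and IHx: "c m (h x) = (\<Sum>s\<in>Poly_Mapping.keys x. of_int (Poly_Mapping.lookup x s) * c m s)"
      and IHy: "c m (h y) = (\<Sum>s\<in>Poly_Mapping.keys y. of_int (Poly_Mapping.lookup y s) * c m s)"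
    let ?K = "Poly_Mapping.keys x \<union> Poly_Mapping.keys y"
    have ext: "(\<Sum>s\<in>Poly_Mapping.keys z. of_int (Poly_Mapping.lookup z s) * c m s)
      = (\<Sum>s\<in>?K. of_int (Poly_Mapping.lookup z s) * c m s)" if "Poly_Mapping.keys z \<subseteq> ?K" for z
      by (rule sum.mono_neutral_left) (use that in \<open>auto simp: in_keys_iff\<close>)
    \<comment> \<open>The induction rule proceeds by differences while h preserves products, so
      \<open>h x\<close> is split as the product of \<open>h (x - y)\<close> and
      \<open>h y\<close>.\<close>
    have "c m (h x) = c m (h (x - y)) + c m (h y)"
    proof -
      have xyS: "Poly_Mapping.keys (x - y) \<subseteq> S" using xS yS keys_diff[of x y] by blast
      have "h x = h (x - y) \<otimes> h y"
        using h.hom_mult[of "x - y" y] xyS yS by simp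
      then show ?thesis using add xyS yS h.hom_closed by simp
    qed
    then have "c m (h (x - y)) = c m (h x) - c m (h y)" by simp
    also have "\<dots> = (\<Sum>s\<in>?K. of_int (Poly_Mapping.lookup (x - y) s) * c m s)"
      unfolding IHx IHy by (subst (1 2) ext) (auto simp: sum_subtractf algebra_simps lookup_minus)
    finally show "c m (h (x - y)) =
      (\<Sum>s\<in>Poly_Mapping.keys (x - y). of_int (Poly_Mapping.lookup (x - y) s) * c m s)"
      by (subst ext) (use keys_diff[of x y] in auto)
  qed
  have "inj_on h (carrier ?A)"
  proof (rule h.inj_on_one_iff[THEN iffD2], intro allI impI)
    fix x assume xA: "x \<in> carrier ?A" and hx: "h x = \<one>"
    show "x = \<one>\<^bsub>?A\<^esub>"
    proof (rule ccontr)
      assume "x \<noteq> \<one>\<^bsub>?A\<^esub>"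
      then have ne: "Poly_Mapping.keys x \<noteq> {}" by simp
      define Z where "Z = {n\<in>T. b n \<in> Poly_Mapping.keys x}"
      have keysZ: "Poly_Mapping.keys x = b ` Z" using xA by (auto simp: Z_def S_def)
      have finZ: "finite Z" 
        using finite_imageD[of b Z] keysZ b_inj finite_keys[of x] by (metis (mono_tags, lifting) Z_def inj_on_subset mem_Collect_eq subsetI)
      have Zne: "Z \<noteq> {}" using keysZ ne by auto
      \<comment> \<open>At the top level n, \<open>b n\<close> is the only basis element involved
        whose n-th coordinate is nonzero, so nothing can cancel it.\<close>
      define n where "n = Max Z"
      have nZ: "n \<in> Z" using finZ Zne n_def by simp
      have "c n (h x) = (\<Sum>s\<in>b ` Z. of_int (Poly_Mapping.lookup x s) * c n s)"
        using lin[of x n] xA keysZ by simp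
      also have "\<dots> = (\<Sum>s\<in>{b n}. of_int (Poly_Mapping.lookup x s) * c n s)"
      proof (rule sum.mono_neutral_right)
        show "\<forall>s\<in>b ` Z - {b n}. of_int (Poly_Mapping.lookup x s) * c n s = 0"
        proof
          fix s assume "s \<in> b ` Z - {b n}"
          then obtain k where k: "k \<in> Z" "s = b k" "k \<noteq> n" by auto
          then have "k < n" using finZ n_def by (simp add: order_less_le)
          then show "of_int (Poly_Mapping.lookup x s) * c n s = 0" using bzero k by simp
        qed
      qed (use finZ nZ in auto)
      also have "\<dots> \<noteq> 0" using nZ by (auto simp: Z_def T_def in_keys_iff)
      finally show False using hx one by simp
    qed
  qed
  moreover have "h ` carrier ?A = carrier G"
  proof
    show "carrier G \<subseteq> h ` carrier ?A"
    proof
      have "x \<in> F n \<longrightarrow> x \<in> h ` carrier ?A" for x n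
      proof (induction n arbitrary: x)
        case 0
        have "\<one> \<in> h ` carrier ?A" by (rule image_eqI[of _ _ 0]) (use h.hom_one in simp_all)
        then show ?case using inj[of x] by (auto simp: F_def)
      next
        case (Suc n)
        show ?case
        proof
          assume x: "x \<in> F (Suc n)"
          then have xG: "x \<in> carrier G" by (simp add: F_def)
          obtain k :: int where k: "c n x = of_int k * c n (b n)" using bgen[OF x] by blast
          show "x \<in> h ` carrier ?A"
          proof (cases "n \<in> T")
            case True
            let ?y = "x \<otimes> b n [^] (-k)"
            have "?y \<in> F (Suc n)" by (rule F_pow[OF x bF])
            moreover have "c n ?y = 0" using k xG bcar by (simp add: add pow del: int_pow_neg)
            ultimately have "?y \<in> F n" by (auto simp: F_def) (metis le_antisym not_less_eq_eq)
            then obtain z where z: "z \<in> carrier ?A" "h z = ?y" using Suc.IH by (metis imageE)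
            have bS: "b n \<in> S" using True S_def by blast
            let ?w = "z \<otimes>\<^bsub>?A\<^esub> frag_of (b n) [^]\<^bsub>?A\<^esub> k"
            have fr: "frag_of (b n) \<in> carrier ?A" using bS by simp
            have kc: "frag_of (b n) [^]\<^bsub>?A\<^esub> k \<in> carrier ?A"
              by (rule group.int_pow_closed[OF group_free_Abelian_group fr])
            have w: "?w \<in> carrier ?A"
              using z(1) kc by (metis group_free_Abelian_group group.is_monoid monoid.m_closed)
            have "h ?w = ?y \<otimes> b n [^] k"
              using h.hom_mult[OF z(1) kc] h.hom_int_pow[OF fr] z h(2)[OF bS] by simp
            also have "\<dots> = x" using xG bcar[of n] by (simp add: m_assoc int_pow_neg)
            finally show ?thesis using w by blast
          next
            case False
            then have "c n x = 0" using k by (simp add: T_def)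
            then have "x \<in> F n" using x by (auto simp: F_def) (metis le_antisym not_less_eq_eq)
            then show ?thesis using Suc.IH by blast
          qed
        qed
      qed
      moreover fix x assume x: "x \<in> carrier G"
      obtain n where "\<forall>m\<in>{n. c n x \<noteq> 0}. m < n"
        using fin[OF x] finite_nat_set_iff_bounded by blast
      then have "x \<in> F n" using x by (auto simp: F_def)
      ultimately show "x \<in> h ` carrier ?A" by blast
    qed
  qed auto
  ultimately have "h \<in> iso ?A G" using h(1) by (simp add: iso_def bij_betw_def)
  then have "G \<cong> ?A" by (meson group.iso_sym group_free_Abelian_group is_isoI)
  then show ?thesis using G by (auto simp: free_abelian_def)
qed

subsection \<open>Finitely supported functions\<close>

lemma sum_fun_apply: "sum f S x = (\<Sum>i\<in>S. f i x)"
  by (induction S rule: infinite_finite_induct) auto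

lemma uncountable_infinite_fiber:
  assumes "uncountable A" "f ` A \<subseteq> C" "countable C"
  obtains c where "infinite {a\<in>A. f a = c}"
proof -
  have "A \<subseteq> (\<Union>c\<in>C. {a\<in>A. f a = c})" using assms(2) by auto
  then have "\<not> (\<forall>c\<in>C. countable {a\<in>A. f a = c})"
    using assms(1,3) by (meson countable_UN countable_subset)
  then show ?thesis using that countable_finite by blast
qed

lemma int_dvd_unbounded_imp_0:
  fixes a :: int
  assumes "\<And>N. \<exists>n::nat\<ge>N. int n dvd a"
  shows "a = 0"
proof (rule ccontr)
  assume "a \<noteq> 0"
  obtain n where "n \<ge> Suc (nat \<bar>a\<bar>)" "int n dvd a" using assms by blast
  then show False using dvd_imp_le_int[OF \<open>a \<noteq> 0\<close>] by fastforce
qed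

text \<open>The graph over the support codes a finitely supported function as a finite set of pairs,
  so that counting functions reduces to counting finite subsets.\<close>

lemma inj_on_graph_image: "inj_on (\<lambda>f. (\<lambda>i. (i, f i)) ` {i. f i \<noteq> (0::'b::zero)}) UNIV"
proof (rule inj_onI)
  fix f g :: "'a \<Rightarrow> 'b"
  assume eq: "(\<lambda>i. (i, f i)) ` {i. f i \<noteq> 0} = (\<lambda>i. (i, g i)) ` {i. g i \<noteq> 0}"
  have "f i = g i" for i
  proof -
    have "(i, y) \<in> (\<lambda>i. (i, f i)) ` {i. f i \<noteq> 0} \<longleftrightarrow> y = f i \<and> f i \<noteq> 0" for y by auto
    moreover have "(i, y) \<in> (\<lambda>i. (i, g i)) ` {i. g i \<noteq> 0} \<longleftrightarrow> y = g i \<and> g i \<noteq> 0" for y by auto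
    ultimately show ?thesis using eq by metis
  qed
  then show "f = g" by blast
qed

lemma countable_finite_support:
  assumes "countable J" "countable C"
  shows "countable {f. finite {i. f i \<noteq> (0::'b::zero)} \<and> {i. f i \<noteq> 0} \<subseteq> J \<and> range f \<subseteq> C}" (is "countable ?S")
proof -
  have "(\<lambda>f. (\<lambda>i. (i, f i)) ` {i. f i \<noteq> 0}) ` ?S \<subseteq> {F. finite F \<and> F \<subseteq> J \<times> C}"
    by auto
  moreover have "countable {F. finite F \<and> F \<subseteq> J \<times> C}"
    using assms by (intro countable_Collect_finite_subset countable_SIGMA)
  ultimately have "countable ((\<lambda>f. (\<lambda>i. (i, f i)) ` {i. f i \<noteq> 0}) ` ?S)" by (rule countable_subset)
  then show ?thesis by (rule countable_image_inj_on) (rule inj_on_subset[OF inj_on_graph_image subset_UNIV])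
qed

subsection \<open>Locally constant functions on the Cantor space\<close>

text \<open>By compactness of the Cantor space, local constancy means dependence on finitely many
  bits. The values are rational because tails have denominators; integrality is imposed
  separately.\<close>

definition loc :: "(nat set \<Rightarrow> rat) \<Rightarrow> bool" where
  "loc f \<longleftrightarrow> (\<exists>n. \<forall>A. f A = f (A \<inter> {..<n}))"

lemma loc_const [simp]: "loc (\<lambda>_. c)" "loc 0"
  by (auto simp: loc_def)

lemma loc_binop:
  assumes "loc f" "loc g"
  shows "loc (\<lambda>A. h (f A) (g A))"
proof -
  obtain m n where m: "\<forall>A. f A = f (A \<inter> {..<m})" and n: "\<forall>A. g A = g (A \<inter> {..<n})"
    using assms unfolding loc_def by blast
  have "h (f A) (g A) = h (f (A \<inter> {..<max m n})) (g (A \<inter> {..<max m n}))" for A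
  proof -
    have "A \<inter> {..<max m n} \<inter> {..<m} = A \<inter> {..<m}" "A \<inter> {..<max m n} \<inter> {..<n} = A \<inter> {..<n}" by auto
    then have "f (A \<inter> {..<max m n}) = f A" "g (A \<inter> {..<max m n}) = g A"
      using m[rule_format, of "A \<inter> {..<max m n}"] m[rule_format, of A]
        n[rule_format, of "A \<inter> {..<max m n}"] n[rule_format, of A] by argo+
    then show ?thesis by simp
  qed
  then show ?thesis unfolding loc_def by blast
qed

lemma loc_add: "loc f \<Longrightarrow> loc g \<Longrightarrow> loc (\<lambda>A. f A + g A)"
  and loc_diff: "loc f \<Longrightarrow> loc g \<Longrightarrow> loc (\<lambda>A. f A - g A)"
  and loc_mult: "loc f \<Longrightarrow> loc g \<Longrightarrow> loc (\<lambda>A. f A * g A)"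
  and loc_divide: "loc f \<Longrightarrow> loc g \<Longrightarrow> loc (\<lambda>A. f A / g A)"
  by (rule loc_binop; assumption)+

lemma loc_plus: "loc f \<Longrightarrow> loc g \<Longrightarrow> loc (f + g)"
  and loc_times: "loc f \<Longrightarrow> loc g \<Longrightarrow> loc (f * g)"
  by (simp_all add: plus_fun_def times_fun_def loc_add loc_mult)

lemma loc_uminus: "loc f \<Longrightarrow> loc (\<lambda>A. - f A)"
  using loc_diff[of "\<lambda>_. 0" f] by simp

lemma loc_member: "loc (\<lambda>A. if n \<in> A then a else b)"
  unfolding loc_def by (rule exI[of _ "Suc n"]) auto

text \<open>A function that reads only n bits is determined by its values on the finitely many
  subsets of \<open>{..<n}\<close>. The pigeonhole argument on branches rests on this
  countability.\<close>

lemma countable_loc: "countable {f. loc f}"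
proof -
  have fins: "countable {A::nat set. finite A}" by (rule countable_Collect_finite)
  have "countable {f::nat set \<Rightarrow> rat. \<forall>A. f A = f (A \<inter> {..<n})}" (is "countable ?S") for n :: nat
  proof -
    let ?h = "\<lambda>f::nat set \<Rightarrow> rat. (\<lambda>A. (A, f A)) ` Pow {..<n}"
    have "inj_on ?h ?S"
    proof (rule inj_onI)
      fix f g :: "nat set \<Rightarrow> rat" assume fS: "f \<in> ?S" and gS: "g \<in> ?S" and eq: "?h f = ?h g"
      have "f A = g A" for A
      proof -
        have "(A \<inter> {..<n}, f (A \<inter> {..<n})) \<in> ?h g" unfolding eq[symmetric] by blast
        then show ?thesis using fS gS by force
      qed
      then show "f = g" by blast
    qed
    moreover have "?h ` ?S \<subseteq> {F. finite F \<and> F \<subseteq> {A. finite A} \<times> UNIV}"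
      by (auto intro: finite_subset)
    moreover have "countable {F. finite F \<and> F \<subseteq> {A::nat set. finite A} \<times> (UNIV :: rat set)}"
      using fins by (intro countable_Collect_finite_subset countable_SIGMA) auto
    ultimately show ?thesis by (metis (no_types, lifting) countable_image_inj_on countable_subset)
  qed
  then have "countable (\<Union>n. {f::nat set \<Rightarrow> rat. \<forall>A. f A = f (A \<inter> {..<n})})" by blast
  moreover have "{f. loc f} = (\<Union>n. {f. \<forall>A. f A = f (A \<inter> {..<n})})" by (auto simp: loc_def)
  ultimately show ?thesis by simp
qed

text \<open>Finite sets form a tree in which the parent of A is A without its maximum. The value at
  \<open>{}\<close> and the increments along this tree serve as rational coordinates of f, as the
  freeness criterion demands.\<close>

lemma loc_eq_0_if_increments_0:
  assumes "loc f" and "f {} = 0" and "\<And>A. finite A \<Longrightarrow> A \<noteq> {} \<Longrightarrow> f A = f (A - {Max A})"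
  shows "f = 0"
proof -
  have fin: "f A = 0" if "finite A" for A
    using that
  proof (induction "card A" arbitrary: A)
    case (Suc n)
    then have "A \<noteq> {}" by auto
    then have "card (A - {Max A}) = n" using Suc by simp
    then show ?case using Suc assms(3)[OF Suc.prems \<open>A \<noteq> {}\<close>] by (metis finite_Diff)
  qed (use assms(2) in simp)
  obtain n where "\<forall>A. f A = f (A \<inter> {..<n})" using assms(1) loc_def by blast
  then have "f A = 0" for A using fin[of "A \<inter> {..<n}"] by (metis finite_Int finite_lessThan)
  then show ?thesis by auto
qed

text \<open>If A has an element beyond the bits that f reads, then removing its maximum changes none
  of these bits.\<close>

lemma loc_finite_increments:
  assumes "loc f"
  shows "finite {A. finite A \<and> A \<noteq> {} \<and> f A \<noteq> f (A - {Max A})}"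
proof -
  obtain n where n: "\<forall>A. f A = f (A \<inter> {..<n})" using assms unfolding loc_def by blast
  have "A \<subseteq> {..<n}" if A: "finite A" "A \<noteq> {}" "f A \<noteq> f (A - {Max A})" for A
  proof (rule ccontr)
    assume "\<not> A \<subseteq> {..<n}"
    then obtain a where "a \<in> A" "a \<ge> n" by (meson lessThan_iff not_less subsetI)
    then have "Max A \<ge> n" using A(1) by (meson Max_ge le_trans)
    then have "A \<inter> {..<n} = (A - {Max A}) \<inter> {..<n}" by fastforce
    then show False using n[rule_format, of A] n[rule_format, of "A - {Max A}"] A(3) by argo
  qed
  then have "{A. finite A \<and> A \<noteq> {} \<and> f A \<noteq> f (A - {Max A})} \<subseteq> Pow {..<n}" by blast
  then show ?thesis by (rule finite_subset) simp
qed

subsection \<open>Tree nodes and branches\<close>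

type_synonym branch = "nat \<times> nat set"
type_synonym elt = "nat + branch \<Rightarrow> nat set \<Rightarrow> rat"

text \<open>The branch \<open>(k, Y)\<close> lies in the k-th tree, which belongs to the k-th element of the base group;
  \<open>Inl t\<close> is the coordinate of the node t and \<open>Inr v\<close> that of \<open>y\<^sub>v\<close>.\<close>

definition node :: "branch \<Rightarrow> nat \<Rightarrow> nat" where
  "node v j = prod_encode (fst v, prod_encode (j, set_encode (snd v \<inter> {..<j})))"

lemma node_eq_iff: "node v i = node w j \<longleftrightarrow> fst v = fst w \<and> i = j \<and> snd v \<inter> {..<i} = snd w \<inter> {..<i}"
  unfolding node_def by (auto simp: prod_encode_eq set_encode_eq)

text \<open>The nodes of a branch therefore leave every finite set, and their primes are
  unbounded.\<close>

lemma node_ge: "node v j \<ge> j"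
  unfolding node_def by (meson le_prod_encode_1 le_prod_encode_2 le_trans)

lemma node_neq_later:
  assumes "node v N \<noteq> node w N" "j \<ge> N"
  shows "node v j \<noteq> node w i"
proof
  assume "node v j = node w i"
  then have "fst v = fst w" "snd v \<inter> {..<j} = snd w \<inter> {..<j}" by (auto simp: node_eq_iff)
  moreover have "{..<N} = {..<j} \<inter> {..<N}" using assms(2) by auto
  ultimately have "node v N = node w N" by (metis Int_assoc node_eq_iff)
  then show False using assms(1) by simp
qed

lemma branches_separate:
  assumes "v \<noteq> w"
  obtains N where "\<And>j. j \<ge> N \<Longrightarrow> node v j \<noteq> node w j"
proof -
  have "\<exists>N. node v N \<noteq> node w N"
  proof (cases "fst v = fst w")
    case False
    then show ?thesis by (auto simp: node_eq_iff)
  next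
    case True
    then have "snd v \<noteq> snd w" using assms by (simp add: prod_eq_iff)
    then obtain n where "n \<in> snd v \<longleftrightarrow> n \<notin> snd w" by blast
    then have "snd v \<inter> {..<Suc n} \<noteq> snd w \<inter> {..<Suc n}" by auto
    then show ?thesis by (metis node_eq_iff)
  qed
  then show ?thesis using that node_neq_later by metis
qed

definition prm :: "nat \<Rightarrow> nat" where
  "prm = enumerate {p. prime p}"

lemma prime_prm: "prime (prm n)"
  using enumerate_in_set[OF primes_infinite] by (auto simp: prm_def)

lemma strict_mono_prm: "strict_mono prm"
  unfolding prm_def by (rule strict_mono_enumerate[OF primes_infinite])

lemma prm_eq_iff [simp]: "prm m = prm n \<longleftrightarrow> m = n"
  using strict_mono_prm by (simp add: strict_mono_eq)

lemma prm_ge: "prm n \<ge> n"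
  using strict_mono_prm by (rule strict_mono_imp_increasing)

definition q :: "branch \<Rightarrow> nat \<Rightarrow> nat" where
  "q v j = (\<Prod>i<j. prm (node v i))"

lemma q_0 [simp]: "q v 0 = 1" and q_Suc: "q v (Suc j) = q v j * prm (node v j)"
  by (auto simp: q_def)

lemma q_pos [simp]: "q v j > 0" "q v j \<noteq> 0"
  by (auto simp: q_def prime_gt_0_nat prime_prm)

lemma q_dvd: "i \<le> j \<Longrightarrow> q v i dvd q v j"
  unfolding q_def by (rule prod_dvd_prod_subset) auto

text \<open>This is the arithmetic source of the incomparability of types: denominators along w
  involve only primes of nodes on w.\<close>

lemma not_prm_dvd_q: "(\<And>i. node w i \<noteq> t) \<Longrightarrow> \<not> prm t dvd q w j"
  unfolding q_def prime_dvd_prod_iff[OF finite_lessThan prime_prm]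
  by (metis prime_prm prm_eq_iff primes_dvd_imp_eq)

subsection \<open>The integral base group\<close>

text \<open>The free module B, with a basis vector for every natural number; the codes of nodes are
  among these indices.\<close>

definition base :: "(nat \<Rightarrow> nat set \<Rightarrow> rat) set" where
  "base = {b. finite {t. b t \<noteq> 0} \<and> (\<forall>t. loc (b t)) \<and> (\<forall>t A. b t A \<in> \<int>)}"

lemma countable_base: "countable base"
proof -
  have "base \<subseteq> {f. finite {i. f i \<noteq> 0} \<and> {i. f i \<noteq> 0} \<subseteq> UNIV \<and> range f \<subseteq> {f. loc f}}"
    by (auto simp: base_def)
  then show ?thesis
    by (rule countable_subset[OF _ countable_finite_support[OF countableI_type countable_loc]])
qed

lemma base_0: "0 \<in> base"
  by (simp add: base_def)

lemma finite_support_add: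
  fixes a b :: "'i \<Rightarrow> 'b::monoid_add"
  assumes "finite {t. a t \<noteq> 0}" "finite {t. b t \<noteq> 0}"
  shows "finite {t. (a + b) t \<noteq> 0}"
  by (rule finite_subset[of _ "{t. a t \<noteq> 0} \<union> {t. b t \<noteq> 0}"]) (use assms in auto)

lemma finite_support_scale:
  fixes b :: "'i \<Rightarrow> 'b::mult_zero"
  assumes "finite {t. b t \<noteq> 0}"
  shows "finite {t. r * b t \<noteq> 0}"
  by (rule finite_subset[OF _ assms]) auto

lemma base_add: "a \<in> base \<Longrightarrow> b \<in> base \<Longrightarrow> a + b \<in> base"
  by (simp add: base_def finite_support_add[simplified] loc_plus)

lemma base_scale:
  assumes "b \<in> base" "loc r" "\<And>A. r A \<in> \<int>"
  shows "(\<lambda>t. r * b t) \<in> base"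
  using assms by (simp add: base_def finite_support_scale loc_times)

lemma base_sum: "(\<And>i. i \<in> S \<Longrightarrow> f i \<in> base) \<Longrightarrow> sum f S \<in> base"
  by (induction S rule: infinite_finite_induct) (auto intro: base_add base_0)

definition dec :: "nat \<Rightarrow> nat \<Rightarrow> nat set \<Rightarrow> rat" where
  "dec = from_nat_into base"

lemma dec_base: "dec k \<in> base"
  unfolding dec_def using base_0 by (metis empty_iff from_nat_into)

lemma dec_surj:
  assumes "b \<in> base" obtains k where "dec k = b"
  using assms countable_base that unfolding dec_def by (metis from_nat_into_to_nat_on)

definition unit_at :: "nat \<Rightarrow> nat \<Rightarrow> nat set \<Rightarrow> rat" where
  "unit_at t = (\<lambda>s A. if s = t then 1 else 0)"

lemma unit_at_base: "unit_at t \<in> base"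
proof -
  have "{s. unit_at t s \<noteq> 0} \<subseteq> {t}" by (auto simp: unit_at_def zero_fun_def)
  then have "finite {s. unit_at t s \<noteq> 0}" using finite_subset by blast
  moreover have "loc (unit_at t s)" for s unfolding unit_at_def by simp
  ultimately show ?thesis by (simp add: base_def) (simp add: unit_at_def)
qed

definition corr :: "branch \<Rightarrow> nat \<Rightarrow> nat \<Rightarrow> nat set \<Rightarrow> rat" where
  "corr v j = unit_at (node v j) + (if j \<in> snd v then dec (fst v) else 0)"

lemma corr_base: "corr v j \<in> base"
  by (auto simp: corr_def intro: base_add unit_at_base dec_base base_0)

definition part :: "branch \<Rightarrow> nat \<Rightarrow> nat \<Rightarrow> nat set \<Rightarrow> rat" where
  "part v K = (\<Sum>j<K. of_nat (q v j) * corr v j)"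

lemma part_0 [simp]: "part v 0 = 0"
  and part_Suc: "part v (Suc K) = part v K + of_nat (q v K) * corr v K"
  by (auto simp: part_def)

lemma base_of_nat_mult: "b \<in> base \<Longrightarrow> of_nat n * b \<in> base"
  using base_scale[of b "of_nat n"] by (simp add: times_fun_def of_nat_fun)

lemma part_base: "part v K \<in> base"
  unfolding part_def by (intro base_sum base_of_nat_mult corr_base)

lemma base_Ints: "b \<in> base \<Longrightarrow> b t A \<in> \<int>" and base_loc: "b \<in> base \<Longrightarrow> loc (b t)"
  by (auto simp: base_def)

subsection \<open>The group\<close>

declare split_paired_All [simp del] split_paired_Ex [simp del]

definition smul :: "(nat set \<Rightarrow> rat) \<Rightarrow> elt \<Rightarrow> elt" where
  "smul r g = (\<lambda>i. r * g i)"

text \<open>Writing y_v as \<open>part v K\<close> plus \<open>q v K\<close> times its tail and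
  collecting the terms outside the tails gives this base component of g.\<close>

definition ipart :: "elt \<Rightarrow> nat \<Rightarrow> nat \<Rightarrow> nat set \<Rightarrow> rat" where
  "ipart g K t = g (Inl t) + (\<Sum>v | g (Inr v) \<noteq> 0. g (Inr v) * part v K t)"

definition integral_at :: "elt \<Rightarrow> nat \<Rightarrow> bool" where
  "integral_at g K \<longleftrightarrow> (\<forall>v A. of_nat (q v K) * g (Inr v) A \<in> \<int>) \<and> (\<forall>t A. ipart g K t A \<in> \<int>)"

text \<open>\<open>part v K\<close> is the partial sum of \<open>y\<^sub>v\<close>, so \<open>integral_at g K\<close> says that g is an integral
  combination of base elements and the tails \<open>(y\<^sub>v - part v K) / q v K\<close>.\<close>

definition tree_group :: "nat set set \<Rightarrow> elt set" where
  "tree_group X = {g. finite {i. g i \<noteq> 0} \<and> (\<forall>i. loc (g i)) \<and>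
     (\<forall>v. g (Inr v) \<noteq> 0 \<longrightarrow> snd v \<in> X) \<and> (\<exists>K. integral_at g K)}"

lemma smul_apply [simp]: "smul r g i A = r A * g i A"
  by (simp add: smul_def)

lemma finite_branch_support:
  fixes g :: elt
  assumes "finite {i. g i \<noteq> 0}" shows "finite {v. g (Inr v) \<noteq> 0}"
  using finite_vimageI[OF assms, of Inr] by (simp add: vimage_def)

lemma ipart_superset:
  assumes "finite F" "{v. g (Inr v) \<noteq> 0} \<subseteq> F"
  shows "ipart g K t = g (Inl t) + (\<Sum>v\<in>F. g (Inr v) * part v K t)"
  unfolding ipart_def by (rule arg_cong[where f = "(+) _"], rule sum.mono_neutral_left) (use assms in auto)

lemma ipart_add:
  fixes g h :: elt
  assumes "finite {i. g i \<noteq> 0}" "finite {i. h i \<noteq> 0}"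
  shows "ipart (g + h) K t = ipart g K t + ipart h K t"
proof -
  let ?F = "{v. g (Inr v) \<noteq> 0} \<union> {v. h (Inr v) \<noteq> 0}"
  have F: "finite ?F" using assms by (simp add: finite_branch_support)
  show ?thesis
    by (subst (1 2 3) ipart_superset[OF F]) (auto simp: sum.distrib algebra_simps)
qed

lemma ipart_smul:
  assumes "finite {i. g i \<noteq> 0}"
  shows "ipart (smul r g) K t = r * ipart g K t"
proof -
  let ?F = "{v. g (Inr v) \<noteq> 0}"
  have F: "finite ?F" using assms by (simp add: finite_branch_support)
  show ?thesis
    by (subst (1 2) ipart_superset[OF F]) (auto simp: smul_def sum_distrib_left algebra_simps)
qed

text \<open>Each term added from level N on carries a factor \<open>q v j\<close>, which is a
  multiple of \<open>q v N\<close>.\<close>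

lemma part_diff_Ints:
  assumes "N \<le> K" "of_nat (q v N) * x \<in> \<int>"
  shows "x * part v K t A - x * part v N t A \<in> \<int>"
  using assms(1)
proof (induction K rule: dec_induct)
  case (step K)
  obtain d where "q v K = q v N * d" using q_dvd[OF step.hyps(1)] by (metis dvdE)
  then have "x * part v (Suc K) t A - x * part v N t A
      = (x * part v K t A - x * part v N t A) + of_nat d * (of_nat (q v N) * x) * corr v K t A"
    by (simp add: part_Suc algebra_simps)
  also have "\<dots> \<in> \<int>" using step.IH assms(2) base_Ints[OF corr_base] by simp
  finally show ?case .
qed simp

lemma ipart_diff_Ints:
  assumes "finite {i. g i \<noteq> 0}" "\<And>v A. of_nat (q v N) * g (Inr v) A \<in> \<int>" "N \<le> K"
  shows "ipart g K t A - ipart g N t A \<in> \<int>"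
proof -
  have "ipart g K t A - ipart g N t A
    = (\<Sum>v | g (Inr v) \<noteq> 0. g (Inr v) A * part v K t A - g (Inr v) A * part v N t A)"
    by (simp add: ipart_def sum_fun_apply sum_subtractf)
  also have "\<dots> \<in> \<int>" by (intro Ints_sum part_diff_Ints assms)
  finally show ?thesis .
qed

text \<open>A tail is an integral combination of base elements and any later tail. Hence finitely
  many elements can be treated at one common level.\<close>

lemma integral_at_mono:
  assumes "finite {i. g i \<noteq> 0}" "integral_at g N" "N \<le> K"
  shows "integral_at g K"
proof -
  have "of_nat (q v K) * g (Inr v) A \<in> \<int>" for v A
  proof -
    obtain d where d: "q v K = d * q v N" using q_dvd[OF assms(3)] by (metis dvdE mult.commute)
    have "of_nat d * (of_nat (q v N) * g (Inr v) A) \<in> \<int>" using assms(2) by (simp add: integral_at_def)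
    then show ?thesis by (simp add: d mult.assoc)
  qed
  moreover have "ipart g K t A \<in> \<int>" for t A
    using ipart_diff_Ints[OF assms(1) _ assms(3), of t A] assms(2) Ints_add[of "ipart g K t A - ipart g N t A" "ipart g N t A"]
    by (simp add: integral_at_def)
  ultimately show ?thesis by (simp add: integral_at_def)
qed

lemma tree_groupI:
  assumes "finite {i. g i \<noteq> 0}" "\<And>i. loc (g i)" "\<And>v. g (Inr v) \<noteq> 0 \<Longrightarrow> snd v \<in> X" "integral_at g K"
  shows "g \<in> tree_group X"
  using assms unfolding tree_group_def by blast

lemma tree_group_finite: "g \<in> tree_group X \<Longrightarrow> finite {i. g i \<noteq> 0}"
  and tree_group_loc: "g \<in> tree_group X \<Longrightarrow> loc (g i)"
  and tree_group_branch: "g \<in> tree_group X \<Longrightarrow> g (Inr v) \<noteq> 0 \<Longrightarrow> snd v \<in> X"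
  by (auto simp: tree_group_def)

lemma tree_group_0: "0 \<in> tree_group X"
  by (auto simp: tree_group_def integral_at_def ipart_def)

lemma tree_group_add:
  assumes "g \<in> tree_group X" "h \<in> tree_group X"
  shows "g + h \<in> tree_group X"
proof -
  have fin: "finite {i. g i \<noteq> 0}" "finite {i. h i \<noteq> 0}" using assms tree_group_finite by auto
  obtain K L where "integral_at g K" "integral_at h L" using assms by (auto simp: tree_group_def)
  then have "integral_at g (max K L)" "integral_at h (max K L)"
    using fin by (auto intro: integral_at_mono)
  then have "integral_at (g + h) (max K L)"
    by (simp add: integral_at_def ipart_add[OF fin] distrib_left)
  moreover have "finite {i. (g + h) i \<noteq> 0}" by (rule finite_support_add[OF fin])
  moreover have "(g + h) (Inr v) \<noteq> 0 \<Longrightarrow> snd v \<in> X" for v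
    using assms tree_group_branch by (metis add.right_neutral plus_fun_apply)
  ultimately show ?thesis
    using assms by (auto simp: tree_group_def loc_plus)
qed

lemma tree_group_smul:
  assumes "g \<in> tree_group X" "loc r" "\<And>A. r A \<in> \<int>"
  shows "smul r g \<in> tree_group X"
proof -
  have fin: "finite {i. g i \<noteq> 0}" using assms(1) tree_group_finite by auto
  obtain K where "integral_at g K" using assms by (auto simp: tree_group_def)
  then have "integral_at (smul r g) K"
    using assms(3) by (simp add: integral_at_def ipart_smul[OF fin] mult.left_commute)
  moreover have "finite {i. smul r g i \<noteq> 0}"
    unfolding smul_def by (rule finite_support_scale[OF fin])
  moreover have "snd v \<in> X" if "smul r g (Inr v) \<noteq> 0" for v
  proof -
    have "g (Inr v) \<noteq> 0" using that by (auto simp: smul_def)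
    then show ?thesis using tree_group_branch[OF assms(1)] by blast
  qed
  moreover have "loc (smul r g i)" for i
    using loc_times[OF assms(2) tree_group_loc[OF assms(1)]] by (simp add: smul_def)
  ultimately show ?thesis by (auto simp: tree_group_def)
qed

lemma of_nat_mult_eq_smul: "of_nat n * g = smul (\<lambda>_. of_nat n) g"
  by (simp add: fun_eq_iff)

lemma tree_group_of_nat_mult: "g \<in> tree_group X \<Longrightarrow> of_nat n * g \<in> tree_group X"
  unfolding of_nat_mult_eq_smul by (rule tree_group_smul) auto

lemma tree_group_uminus: "g \<in> tree_group X \<Longrightarrow> - g \<in> tree_group X"
proof -
  have "- g = smul (\<lambda>_. - 1) g" by (simp add: fun_eq_iff)
  then show "g \<in> tree_group X \<Longrightarrow> - g \<in> tree_group X" by (simp add: tree_group_smul)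
qed

lemma tree_group_diff: "g \<in> tree_group X \<Longrightarrow> h \<in> tree_group X \<Longrightarrow> g - h \<in> tree_group X"
  using tree_group_add[of g X "- h"] tree_group_uminus by simp

lemma tree_group_sum: "(\<And>i. i \<in> S \<Longrightarrow> f i \<in> tree_group X) \<Longrightarrow> sum f S \<in> tree_group X"
  by (induction S rule: infinite_finite_induct) (auto intro: tree_group_add tree_group_0)

definition bel :: "(nat \<Rightarrow> nat set \<Rightarrow> rat) \<Rightarrow> elt" where
  "bel b = case_sum b (\<lambda>_. 0)"

lemma bel_apply [simp]: "bel b (Inl t) = b t" "bel b (Inr v) = 0"
  by (simp_all add: bel_def)

lemma elt_eqI: "(\<And>t. g (Inl t) = h (Inl t)) \<Longrightarrow> (\<And>v. g (Inr v) = h (Inr v)) \<Longrightarrow> g = (h :: elt)"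
  by (metis ext sumE)

lemma bel_add: "bel (a + b) = bel a + bel b"
  and bel_of_nat_mult: "bel (of_nat n * b) = of_nat n * bel b"
  and smul_bel: "smul r (bel b) = bel (\<lambda>t. r * b t)"
  by (auto intro!: elt_eqI simp: smul_def)

lemma bel_in_tree_group: "b \<in> base \<Longrightarrow> bel b \<in> tree_group X"
proof -
  assume b: "b \<in> base"
  have "{i. bel b i \<noteq> 0} \<subseteq> Inl ` {t. b t \<noteq> 0}"
  proof
    fix i assume "i \<in> {i. bel b i \<noteq> 0}"
    then show "i \<in> Inl ` {t. b t \<noteq> 0}" by (cases i) auto
  qed
  then have "finite {i. bel b i \<noteq> 0}" by (rule finite_subset) (use b in \<open>simp add: base_def\<close>)
  moreover have "loc (bel b i)" for i using b by (cases i) (auto simp: base_def)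
  moreover have "integral_at (bel b) 0" using b by (simp add: integral_at_def ipart_def base_def)
  ultimately show ?thesis by (intro tree_groupI[where K = 0]) auto
qed

text \<open>Without branch coordinates \<open>ipart\<close> is the base coordinate itself at every
  level, so adjoining the tails puts no new denominators on B.\<close>

lemma tree_group_no_branch_imp_bel:
  assumes "g \<in> tree_group X" "\<And>v. g (Inr v) = 0"
  obtains b where "b \<in> base" "g = bel b"
proof
  obtain K where "integral_at g K" using assms by (auto simp: tree_group_def)
  then have int: "g (Inl t) A \<in> \<int>" for t A using assms(2) by (simp add: integral_at_def ipart_def)
  have "finite {t. g (Inl t) \<noteq> 0}"
    using finite_vimageI[OF tree_group_finite[OF assms(1)], of Inl] by (simp add: vimage_def)
  then show "(\<lambda>t. g (Inl t)) \<in> base" using int tree_group_loc[OF assms(1)] by (simp add: base_def)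
  show "g = bel (\<lambda>t. g (Inl t))" using assms(2) by (auto intro: elt_eqI)
qed

text \<open>The tail (y_v - \<open>part v K\<close>) / \<open>q v K\<close> in coordinates;
  \<open>yel v 0\<close> is y_v itself.\<close>

definition yel :: "branch \<Rightarrow> nat \<Rightarrow> elt" where
  "yel v K = (\<lambda>i A. (case i of Inl t \<Rightarrow> - part v K t A | Inr w \<Rightarrow> if w = v then 1 else 0) / of_nat (q v K))"

lemma yel_Inl: "yel v K (Inl t) A = - part v K t A / of_nat (q v K)"
  and yel_Inr: "yel v K (Inr w) A = (if w = v then 1 / of_nat (q v K) else 0)"
  by (auto simp: yel_def)

lemma yel_Inr_neq_0: "yel v K (Inr w) \<noteq> 0 \<longleftrightarrow> w = v"
  by (auto simp: fun_eq_iff yel_Inr)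

lemma yel_0: "yel v 0 = of_nat (q v K) * yel v K + bel (part v K)"
  by (rule elt_eqI) (auto simp: fun_eq_iff yel_Inl yel_Inr)

lemma yel_Suc: "yel v K = of_nat (prm (node v K)) * yel v (Suc K) + bel (corr v K)"
proof -
  have p: "prm (node v K) \<noteq> 0" using prime_prm by (metis not_prime_0)
  show ?thesis
    by (rule elt_eqI) (use p in \<open>auto simp: fun_eq_iff yel_Inl yel_Inr q_Suc part_Suc field_simps\<close>)
qed

lemma yel_in_tree_group:
  assumes "snd v \<in> X"
  shows "yel v K \<in> tree_group X"
proof -
  have "{i. yel v K i \<noteq> 0} \<subseteq> insert (Inr v) (Inl ` {t. part v K t \<noteq> 0})"
  proof
    fix i assume i: "i \<in> {i. yel v K i \<noteq> 0}"
    show "i \<in> insert (Inr v) (Inl ` {t. part v K t \<noteq> 0})"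
    proof (cases i)
      case (Inl t)
      then have "part v K t \<noteq> 0" using i by (auto simp: fun_eq_iff yel_Inl)
      then show ?thesis using Inl by blast
    next
      case (Inr w)
      then show ?thesis using i by (simp add: yel_Inr_neq_0)
    qed
  qed
  moreover have "finite (insert (Inr v) (Inl ` {t. part v K t \<noteq> 0}))"
    using part_base[of v K] by (simp add: base_def)
  ultimately have fin: "finite {i. yel v K i \<noteq> 0}" by (rule finite_subset)
  have "loc (yel v K i)" for i
  proof (cases i)
    case (Inl t)
    have "loc (\<lambda>A. - part v K t A / of_nat (q v K))"
      by (intro loc_divide[of "\<lambda>A. - part v K t A"] loc_uminus[of "part v K t"] loc_const base_loc part_base)
    then show ?thesis by (simp add: Inl yel_def)
  qed (simp add: yel_def)
  moreover have "integral_at (yel v K) K"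
  proof -
    have "{w. yel v K (Inr w) \<noteq> 0} \<subseteq> {v}" by (auto simp: yel_Inr_neq_0)
    then have "ipart (yel v K) K t A = 0" for t A
      by (subst ipart_superset[of "{v}"]) (auto simp: yel_Inl yel_Inr)
    then show ?thesis by (simp add: integral_at_def yel_Inr)
  qed
  moreover have "snd w \<in> X" if "yel v K (Inr w) \<noteq> 0" for w
    using that assms by (simp add: yel_Inr_neq_0)
  ultimately show ?thesis by (intro tree_groupI fin)
qed

lemma tree_group_decomp:
  assumes g: "g \<in> tree_group X" and K: "integral_at g K"
  shows "g = bel (ipart g K) + (\<Sum>v | g (Inr v) \<noteq> 0. smul (of_nat (q v K) * g (Inr v)) (yel v K))"
    and "ipart g K \<in> base"
proof -
  let ?F = "{v. g (Inr v) \<noteq> 0}"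
  have fin: "finite ?F" using finite_branch_support tree_group_finite[OF g] .
  show eq: "g = bel (ipart g K) + (\<Sum>v | g (Inr v) \<noteq> 0. smul (of_nat (q v K) * g (Inr v)) (yel v K))"
  proof (rule elt_eqI)
    fix t
    show "g (Inl t) = (bel (ipart g K) + (\<Sum>v\<in>?F. smul (of_nat (q v K) * g (Inr v)) (yel v K))) (Inl t)"
      by (rule ext) (simp add: sum_fun_apply ipart_def yel_Inl sum_negf)
  next
    fix w
    show "g (Inr w) = (bel (ipart g K) + (\<Sum>v\<in>?F. smul (of_nat (q v K) * g (Inr v)) (yel v K))) (Inr w)"
    proof (rule ext)
      fix A
      have "(\<Sum>v\<in>?F. of_nat (q v K) * g (Inr v) A * yel v K (Inr w) A)
          = (\<Sum>v\<in>?F. if v = w then g (Inr w) A else 0)"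
        by (rule sum.cong) (auto simp: yel_Inr)
      also have "\<dots> = g (Inr w) A" using fin by simp
      finally show "g (Inr w) A = (bel (ipart g K) + (\<Sum>v\<in>?F. smul (of_nat (q v K) * g (Inr v)) (yel v K))) (Inr w) A"
        by (simp add: sum_fun_apply)
    qed
  qed
  have "smul (of_nat (q v K) * g (Inr v)) (yel v K) \<in> tree_group X" if "v \<in> ?F" for v
  proof (rule tree_group_smul)
    show "yel v K \<in> tree_group X" using that tree_group_branch[OF g] by (simp add: yel_in_tree_group)
    show "loc (of_nat (q v K) * g (Inr v))"
      unfolding of_nat_fun by (rule loc_times[OF loc_const(1) tree_group_loc[OF g]])
    show "(of_nat (q v K) * g (Inr v)) A \<in> \<int>" for A
      using K by (simp add: integral_at_def)
  qed
  \<comment> \<open>Finite support and local constancy of \<open>ipart g K\<close> need no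
    computation: its image under \<open>bel\<close> is a difference of group elements and has no
    branch coordinates.\<close>
  then have "g - (\<Sum>v | g (Inr v) \<noteq> 0. smul (of_nat (q v K) * g (Inr v)) (yel v K)) \<in> tree_group X"
    by (intro tree_group_diff[OF g] tree_group_sum)
  moreover have "g - (\<Sum>v | g (Inr v) \<noteq> 0. smul (of_nat (q v K) * g (Inr v)) (yel v K)) = bel (ipart g K)"
    by (rule diff_eq_eq[THEN iffD2, OF eq])
  ultimately have "bel (ipart g K) \<in> tree_group X" by simp
  then obtain b where "b \<in> base" "bel (ipart g K) = bel b"
    by (rule tree_group_no_branch_imp_bel) auto
  then show "ipart g K \<in> base" by (metis bel_apply(1) ext)
qed

text \<open>Choose N beyond all nodes in F and all corrections of the finitely many branches in F, and so
  large that these branches have separated. The coordinate of g at the node where v has level N then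
  only sees \<open>y\<^sub>v\<close>, and it must vanish.\<close>

lemma tree_group_uniform:
  assumes F: "finite F"
  obtains N where "\<And>g. g \<in> tree_group X \<Longrightarrow> {i. g i \<noteq> 0} \<subseteq> F \<Longrightarrow> integral_at g N"
proof -
  define W where "W = {v. Inr v \<in> F}"
  define T where "T = {t. Inl t \<in> F} \<union> (\<Union>v\<in>W. {t. dec (fst v) t \<noteq> 0})"
  have W: "finite W" using finite_vimageI[OF F, of Inr] by (simp add: W_def vimage_def)
  have "finite {t. Inl t \<in> F}" using finite_vimageI[OF F, of Inl] by (simp add: vimage_def)
  moreover have "finite {t. dec k t \<noteq> 0}" for k using dec_base[of k] by (simp add: base_def)
  ultimately have T: "finite T" using W by (simp add: T_def)
  have "eventually (\<lambda>j. node v j \<noteq> node w j) sequentially" if "v \<noteq> w" for v w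
  proof -
    obtain N where "\<And>j. j \<ge> N \<Longrightarrow> node v j \<noteq> node w j" using branches_separate[OF \<open>v \<noteq> w\<close>] by blast
    then show ?thesis unfolding eventually_sequentially by blast
  qed
  then have "eventually (\<lambda>j. \<forall>v\<in>W. \<forall>w\<in>W. v \<noteq> w \<longrightarrow> node v j \<noteq> node w j) sequentially"
    by (intro eventually_ball_finite[OF W] ballI) (simp add: eventually_mono)
  moreover have "eventually (\<lambda>j. \<forall>t\<in>T. t < j) sequentially"
    by (intro eventually_ball_finite[OF T] ballI eventually_gt_at_top)
  ultimately have "eventually (\<lambda>j. (\<forall>v\<in>W. \<forall>w\<in>W. v \<noteq> w \<longrightarrow> node v j \<noteq> node w j) \<and> (\<forall>t\<in>T. t < j)) sequentially"
    by (rule eventually_conj)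
  from eventually_happens'[OF sequentially_bot this] obtain N where sep: "\<And>v w. v \<in> W \<Longrightarrow> w \<in> W \<Longrightarrow> v \<noteq> w \<Longrightarrow> node v N \<noteq> node w N"
    and TN: "\<And>t. t \<in> T \<Longrightarrow> t < N"
    by blast
  have "integral_at g N" if g: "g \<in> tree_group X" and supp: "{i. g i \<noteq> 0} \<subseteq> F" for g
  proof -
    have fin: "finite {i. g i \<noteq> 0}" using g by (rule tree_group_finite)
    have suppW: "{v. g (Inr v) \<noteq> 0} \<subseteq> W" using supp by (auto simp: W_def)
    obtain K0 where "integral_at g K0" using g by (auto simp: tree_group_def)
    \<comment> \<open>\<open>Suc N\<close> makes the partial sums long enough to contain the term of
      level N.\<close>
    define K where "K = max K0 (Suc N)"
    have K: "integral_at g K" "N < K"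
      using integral_at_mono[OF fin \<open>integral_at g K0\<close>, of K] by (auto simp: K_def)
    have int: "of_nat (q v N) * g (Inr v) A \<in> \<int>" if v: "v \<in> W" for v A
    proof -
      define t where "t = node v N"
      have tT: "t \<notin> T" using TN node_ge[of N v] t_def by fastforce
      have "Inl t \<notin> F" using tT by (simp add: T_def)
      then have g0: "g (Inl t) = 0" using supp by blast
      have part: "part w K t A = (if w = v then of_nat (q v N) else 0)" if w: "w \<in> W" for w
      proof -
        have "dec (fst w) t = 0" using tT w by (auto simp: T_def)
        moreover have "t = node w j \<longleftrightarrow> w = v \<and> j = N" for j
        proof
          assume eq: "t = node w j"
          then have "j = N" unfolding t_def node_eq_iff by blast
          then show "w = v \<and> j = N" using eq sep[OF w v] t_def by metis
        qed (simp add: t_def)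
        ultimately have "corr w j t A = (if w = v \<and> j = N then 1 else 0)" for j
          by (simp add: corr_def unit_at_def)
        then have "part w K t A = (\<Sum>j<K. if j = N then (if w = v then of_nat (q v N) else 0) else 0)"
          unfolding part_def sum_fun_apply by (intro sum.cong) auto
        also have "\<dots> = (if w = v then of_nat (q v N) else 0)" using K(2) by simp
        finally show ?thesis .
      qed
      \<comment> \<open>Among all terms only the one of v at level N reaches t, with coefficient
        \<open>q v N\<close>. Integrality at the uncontrolled level K thus gives integrality at the
        uniform level N.\<close>
      have "ipart g K t A = (\<Sum>w\<in>W. g (Inr w) A * part w K t A)"
        by (simp add: ipart_superset[OF W suppW] g0 sum_fun_apply)
      also have "\<dots> = (\<Sum>w\<in>W. if w = v then g (Inr v) A * of_nat (q v N) else 0)"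
        by (rule sum.cong) (auto simp: part)
      also have "\<dots> = of_nat (q v N) * g (Inr v) A" using W v by simp
      finally have "ipart g K t A = of_nat (q v N) * g (Inr v) A" .
      then show ?thesis using K(1) unfolding integral_at_def by metis
    qed
    have int': "of_nat (q v N) * g (Inr v) A \<in> \<int>" for v A
    proof (cases "v \<in> W")
      case False
      then have "g (Inr v) = 0" using suppW by blast
      then show ?thesis by simp
    qed (rule int)
    have "ipart g N t A \<in> \<int>" for t A
      using ipart_diff_Ints[OF fin int' less_imp_le[OF K(2)], of t A] K Ints_diff[of "ipart g K t A" "ipart g K t A - ipart g N t A"]
      by (simp add: integral_at_def)
    then show ?thesis using int' by (simp add: integral_at_def)
  qed
  then show ?thesis by (rule that)
qed

text \<open>Pontryagin's criterion gets its finiteness here. At the uniform level N of F the only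
  denominators are the \<open>q v N\<close> of the finitely many branches in F, and D is their
  product.\<close>

lemma tree_group_bounded_denominators:
  assumes F: "finite F"
  obtains D :: nat where "D > 0"
    "\<And>g i A. g \<in> tree_group X \<Longrightarrow> {i. g i \<noteq> 0} \<subseteq> F \<Longrightarrow> of_nat D * g i A \<in> \<int>"
proof -
  obtain N where N: "\<And>g. g \<in> tree_group X \<Longrightarrow> {i. g i \<noteq> 0} \<subseteq> F \<Longrightarrow> integral_at g N"
    using tree_group_uniform[OF F] by blast
  define W where "W = {v. Inr v \<in> F}"
  have W: "finite W" using finite_vimageI[OF F, of Inr] by (simp add: W_def vimage_def)
  define D where "D = (\<Prod>v\<in>W. q v N)"
  have "of_nat D * g i A \<in> \<int>" if g: "g \<in> tree_group X" and supp: "{i. g i \<noteq> 0} \<subseteq> F" for g i A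
  proof -
    have suppW: "{v. g (Inr v) \<noteq> 0} \<subseteq> W" using supp by (auto simp: W_def)
    have integral: "integral_at g N" using N g supp by blast
    have br: "of_nat D * g (Inr v) A \<in> \<int>" for v
    proof (cases "v \<in> W")
      case True
      then obtain d where "D = d * q v N" using dvd_prodI[OF W True, of "\<lambda>v. q v N"] by (metis D_def dvdE mult.commute)
      moreover have "of_nat d * (of_nat (q v N) * g (Inr v) A) \<in> \<int>" using integral by (simp add: integral_at_def)
      ultimately show ?thesis by (simp add: mult.assoc)
    next
      case False
      then have "g (Inr v) = 0" using suppW by blast
      then show ?thesis by simp
    qed
    show ?thesis
    proof (cases i)
      case (Inl t)
      have "of_nat D * g i A = of_nat D * ipart g N t A - (\<Sum>v\<in>W. (of_nat D * g (Inr v) A) * part v N t A)"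
        by (simp add: ipart_superset[OF W suppW] Inl sum_fun_apply sum_distrib_left algebra_simps)
      moreover have "of_nat D * ipart g N t A \<in> \<int>" using integral by (simp add: integral_at_def)
      moreover have "(\<Sum>v\<in>W. (of_nat D * g (Inr v) A) * part v N t A) \<in> \<int>"
        by (intro Ints_sum Ints_mult br base_Ints part_base)
      ultimately show ?thesis by simp
    qed (simp add: br)
  qed
  moreover have "D > 0" by (simp add: D_def prod_pos)
  ultimately show ?thesis by (intro that)
qed

text \<open>A quotient of z has the same support as z, hence the same denominator bound D, so
  arbitrarily large n divide the integers D z.\<close>

lemma tree_group_divisible_eq_0:
  assumes z: "z \<in> tree_group X" and div: "\<And>N. \<exists>n\<ge>N. \<exists>u\<in>tree_group X. z = of_nat n * u"
  shows "z = 0"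
proof -
  obtain D :: nat where D: "D > 0"
    "\<And>g i A. g \<in> tree_group X \<Longrightarrow> {i. g i \<noteq> 0} \<subseteq> {i. z i \<noteq> 0} \<Longrightarrow> of_nat D * g i A \<in> \<int>"
    using tree_group_bounded_denominators[OF tree_group_finite[OF z]] by metis
  have "z i A = 0" for i A
  proof -
    obtain a where a: "of_nat D * z i A = of_int a" using D(2)[OF z] Ints_cases by blast
    have "a = 0"
    proof (rule int_dvd_unbounded_imp_0)
      fix N
      \<comment> \<open>\<open>Suc N\<close> excludes n = 0, for which u could have a larger support
        than z.\<close>
      obtain n u where n: "n \<ge> Suc N" and u: "u \<in> tree_group X" "z = of_nat n * u" using div by blast
      have "z j = 0 \<longleftrightarrow> u j = 0" for j using n by (auto simp: u(2) fun_eq_iff)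
      then have "of_nat D * u i A \<in> \<int>" using D(2)[OF u(1)] by auto
      then obtain b where b: "of_nat D * u i A = of_int b" using Ints_cases by blast
      have "rat_of_int a = of_nat n * (of_nat D * u i A)" using a by (simp add: u(2) mult.left_commute)
      also have "\<dots> = of_int (int n * b)" by (simp add: b)
      finally have "a = int n * b" using of_int_eq_iff by blast
      then show "\<exists>n\<ge>N. int n dvd a" using n by (meson Suc_leD dvd_triv_left)
    qed
    then show ?thesis using a D(1) by simp
  qed
  then show ?thesis by (simp add: fun_eq_iff)
qed

text \<open>One rational coordinate of g for each index i and finite set A; the root
  \<open>{}\<close> has no parent and contributes the value itself.\<close>

definition increment :: "nat + branch \<Rightarrow> nat set \<Rightarrow> elt \<Rightarrow> rat" where
  "increment i A g = (if A = {} then g i {} else g i A - g i (A - {Max A}))"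

text \<open>Finite supports leave countably many pairs of an index and a finite set, and their
  increments are the coordinates of the freeness criterion. The bound it requires at each level
  comes from the bounded denominators over a finite support.\<close>

lemma free_abelian_if_countable_embedding:
  fixes G :: "'a monoid" (structure)
  assumes G: "comm_group G" and count: "countable (carrier G)"
    and emb: "inj_on e (carrier G)" "e ` carrier G \<subseteq> tree_group X"
    and add: "\<And>x y. x \<in> carrier G \<Longrightarrow> y \<in> carrier G \<Longrightarrow> e (x \<otimes> y) = e x + e y"
  shows "free_abelian G"
proof -
  interpret comm_group G by fact
  have eG: "e x \<in> tree_group X" if "x \<in> carrier G" for x using that emb(2) by blast
  have e_one: "e \<one> = 0" using add[of \<one> \<one>] by simp
  define J where "J = (\<Union>x\<in>carrier G. {i. e x i \<noteq> 0}) \<times> {A::nat set. finite A}"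
  have J: "countable J"
    unfolding J_def
    by (intro countable_SIGMA countable_UN count countable_finite[OF tree_group_finite[OF eG]] countable_Collect_finite)
  \<comment> \<open>J may be finite, and then its codes do not exhaust the natural numbers; the
    remaining coordinates are set to 0.\<close>
  define c where "c = (\<lambda>n x. if n \<in> to_nat_on J ` J
      then case_prod increment (from_nat_into J n) (e x) else 0)"
  have c_J: "c (to_nat_on J (i, A)) x = increment i A (e x)" if "(i, A) \<in> J" for i A x
    using that J by (simp add: c_def)
  have c_0: "c n x = 0" if "n \<notin> to_nat_on J ` J" for n x
    using that by (simp add: c_def)
  have vanish: "e x i = 0"
    if x: "x \<in> carrier G" and 0: "\<And>A. (i, A) \<in> J \<Longrightarrow> c (to_nat_on J (i, A)) x = 0" for x i
  proof (rule ccontr)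
    assume nz: "e x i \<noteq> 0"
    then have "(i, A) \<in> J" if "finite A" for A using x that by (auto simp: J_def)
    then have incr: "increment i A (e x) = 0" if "finite A" for A using 0 c_J that by metis
    have "e x i = 0"
    proof (rule loc_eq_0_if_increments_0)
      show "loc (e x i)" using eG[OF x] by (rule tree_group_loc)
      show "e x i {} = 0" using incr[of "{}"] by (simp add: increment_def)
      show "e x i A = e x i (A - {Max A})" if "finite A" "A \<noteq> {}" for A
        using incr[of A] that by (simp add: increment_def)
    qed
    then show False using nz by simp
  qed
  show ?thesis
  proof (rule free_abelian_if_rat_coordinates[OF G, of c])
    show "c n (x \<otimes> y) = c n x + c n y" if "x \<in> carrier G" "y \<in> carrier G" for n x y
      using that by (simp add: c_def add increment_def split: prod.split)
  next
    fix x assume x: "x \<in> carrier G"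
    have "{n. c n x \<noteq> 0} \<subseteq> to_nat_on J ` (\<Union>i\<in>{i. e x i \<noteq> 0}.
        Pair i ` insert {} {A. finite A \<and> A \<noteq> {} \<and> e x i A \<noteq> e x i (A - {Max A})})"
    proof
      fix n assume "n \<in> {n. c n x \<noteq> 0}"
      then obtain i A where iA: "(i, A) \<in> J" "n = to_nat_on J (i, A)" "increment i A (e x) \<noteq> 0"
        using c_0 c_J by (metis (mono_tags, lifting) imageE mem_Collect_eq surj_pair)
      then have "e x i \<noteq> 0" "finite A" by (auto simp: increment_def J_def split: if_splits)
      with iA show "n \<in> to_nat_on J ` (\<Union>i\<in>{i. e x i \<noteq> 0}.
        Pair i ` insert {} {A. finite A \<and> A \<noteq> {} \<and> e x i A \<noteq> e x i (A - {Max A})})"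
        by (force simp: increment_def split: if_splits)
    qed
    moreover have "finite (\<Union>i\<in>{i. e x i \<noteq> 0}.
        Pair i ` insert {} {A. finite A \<and> A \<noteq> {} \<and> e x i A \<noteq> e x i (A - {Max A})})"
      using tree_group_finite[OF eG[OF x]] loc_finite_increments[OF tree_group_loc[OF eG[OF x]]] by blast
    ultimately show "finite {n. c n x \<noteq> 0}" by (meson finite_imageI finite_subset)
  next
    fix x assume x: "x \<in> carrier G" and "\<And>n. c n x = 0"
    then have "e x = 0" using vanish by (metis ext zero_fun_apply)
    then show "x = \<one>" using inj_onD[OF emb(1)] e_one x by simp
  next
    fix n
    \<comment> \<open>Every index in the support of \<open>e x\<close> has some nonzero increment.
      If all coordinates beyond n vanish, its code is at most n, so the support lies in the finite
      set F.\<close>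
    define F where "F = {i. \<exists>A. (i, A) \<in> J \<and> to_nat_on J (i, A) \<le> n}"
    have "F \<subseteq> fst ` {j \<in> J. to_nat_on J j \<le> n}" by (force simp: F_def)
    moreover have "finite {j \<in> J. to_nat_on J j \<le> n}"
    proof -
      have "to_nat_on J ` {j \<in> J. to_nat_on J j \<le> n} \<subseteq> {..n}" by auto
      then have "finite (to_nat_on J ` {j \<in> J. to_nat_on J j \<le> n})" by (rule finite_subset) simp
      then show ?thesis
        by (rule finite_imageD) (rule inj_on_subset[OF inj_on_to_nat_on[OF J]], blast)
    qed
    ultimately have "finite F" by (meson finite_imageI finite_subset)
    then obtain D :: nat where D: "D > 0"
      "\<And>g i A. g \<in> tree_group X \<Longrightarrow> {i. g i \<noteq> 0} \<subseteq> F \<Longrightarrow> of_nat D * g i A \<in> \<int>"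
      using tree_group_bounded_denominators[of F X] by metis
    have "of_nat D * c n x \<in> \<int>" if x: "x \<in> carrier G" "\<forall>m>n. c m x = 0" for x
    proof -
      have "{i. e x i \<noteq> 0} \<subseteq> F"
      proof
        fix i assume "i \<in> {i. e x i \<noteq> 0}"
        then obtain A where "(i, A) \<in> J" "c (to_nat_on J (i, A)) x \<noteq> 0" using vanish[OF x(1)] by blast
        then show "i \<in> F" using x(2) by (metis (mono_tags, lifting) F_def mem_Collect_eq not_le)
      qed
      then have int: "of_nat D * e x i A \<in> \<int>" for i A using D(2) eG[OF x(1)] by blast
      have "of_nat D * increment i A (e x) \<in> \<int>" for i A
        using int by (simp add: increment_def right_diff_distrib)
      then show ?thesis by (simp add: c_def split: prod.split)
    qed
    then show "\<exists>D::nat. D > 0 \<and> (\<forall>x\<in>carrier G. (\<forall>m>n. c m x = 0) \<longrightarrow> of_nat D * c n x \<in> \<int>)"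
      using D(1) by blast
  qed
qed

subsection \<open>Endomorphisms\<close>

definition endo :: "nat set set \<Rightarrow> (elt \<Rightarrow> elt) \<Rightarrow> bool" where
  "endo X f \<longleftrightarrow> (\<forall>g\<in>tree_group X. f g \<in> tree_group X) \<and>
     (\<forall>g\<in>tree_group X. \<forall>h\<in>tree_group X. f (g + h) = f g + f h)"

lemma endo_closed: "endo X f \<Longrightarrow> g \<in> tree_group X \<Longrightarrow> f g \<in> tree_group X"
  and endo_add: "endo X f \<Longrightarrow> g \<in> tree_group X \<Longrightarrow> h \<in> tree_group X \<Longrightarrow> f (g + h) = f g + f h"
  by (auto simp: endo_def)

lemma endo_0: "endo X f \<Longrightarrow> f 0 = 0"
  using endo_add[of X f 0 0] tree_group_0 by simp

lemma endo_of_nat_mult: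
  assumes f: "endo X f" and g: "g \<in> tree_group X"
  shows "f (of_nat n * g) = of_nat n * f g"
proof (induction n)
  case (Suc n)
  have "f (of_nat (Suc n) * g) = f (g + of_nat n * g)"
    by (simp only: of_nat_Suc distrib_right mult_1)
  also have "\<dots> = f g + of_nat n * f g"
    by (simp only: endo_add[OF f g tree_group_of_nat_mult[OF g]] Suc.IH)
  also have "\<dots> = of_nat (Suc n) * f g" by (simp only: of_nat_Suc distrib_right mult_1)
  finally show ?case .
qed (simp only: of_nat_0 mult_zero_left endo_0[OF f])

lemma endo_diff:
  assumes f: "endo X f" and g: "g \<in> tree_group X" and h: "h \<in> tree_group X"
  shows "f (g - h) = f g - f h"
  using endo_add[OF f tree_group_diff[OF g h] h] by simp

lemma endo_sum:
  assumes f: "endo X f" and "\<And>i. i \<in> S \<Longrightarrow> h i \<in> tree_group X"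
  shows "f (sum h S) = (\<Sum>i\<in>S. f (h i))"
  using assms(2)
proof (induction S rule: infinite_finite_induct)
  case (insert i S)
  have "f (sum h (insert i S)) = f (h i + sum h S)"
    by (simp only: sum.insert[OF insert.hyps])
  also have "\<dots> = f (h i) + f (sum h S)"
    by (intro endo_add[OF f] tree_group_sum insert.prems) auto
  also have "\<dots> = f (h i) + (\<Sum>i\<in>S. f (h i))"
    using insert.IH insert.prems by (metis insertI2)
  also have "\<dots> = (\<Sum>i\<in>insert i S. f (h i))"
    by (simp only: sum.insert[OF insert.hyps])
  finally show ?case .
qed (simp_all add: endo_0[OF f])

lemma endo_smul:
  assumes "loc r" "\<And>A. r A \<in> \<int>"
  shows "endo X (smul r)"
  unfolding endo_def using assms by (auto simp: tree_group_smul fun_eq_iff distrib_left)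

lemma endo_minus:
  assumes "endo X f" "endo X h"
  shows "endo X (\<lambda>g. f g - h g)"
  using assms by (auto simp: endo_def tree_group_diff)

lemma endo_compose_of_nat: "endo X f \<Longrightarrow> endo X (\<lambda>g. of_nat n * f g)"
  by (auto simp: endo_def tree_group_of_nat_mult distrib_left)

text \<open>Modulo the base group every element becomes divisible by infinitely many primes.\<close>

lemma endo_eq_0_if_base_0:
  assumes f: "endo X f" and base: "\<And>b. b \<in> base \<Longrightarrow> f (bel b) = 0" and g: "g \<in> tree_group X"
  shows "f g = 0"
proof -
  have yel0: "f (smul r (yel v K)) = 0"
    if r: "loc r" "\<And>A. r A \<in> \<int>" and v: "snd v \<in> X" for r v K
  proof (rule tree_group_divisible_eq_0)
    have y: "smul r (yel v L) \<in> tree_group X" for L by (intro tree_group_smul yel_in_tree_group r v)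
    show "f (smul r (yel v K)) \<in> tree_group X" by (rule endo_closed[OF f y])
    have step: "f (smul r (yel v L)) = of_nat (prm (node v L)) * f (smul r (yel v (Suc L)))" for L
    proof -
      have b: "(\<lambda>t. r * corr v L t) \<in> base" by (intro base_scale corr_base r)
      have "smul r (yel v L) = of_nat (prm (node v L)) * smul r (yel v (Suc L)) + bel (\<lambda>t. r * corr v L t)"
        by (subst yel_Suc) (simp add: fun_eq_iff smul_bel[symmetric] algebra_simps)
      then show ?thesis
        using endo_add[OF f tree_group_of_nat_mult[OF y] bel_in_tree_group[OF b]]
          endo_of_nat_mult[OF f y] base[OF b] by simp
    qed
    have "f (smul r (yel v K)) = of_nat (\<Prod>j<n. prm (node v (K + j))) * f (smul r (yel v (K + n)))" for n
    proof (induction n)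
      case (Suc n)
      show ?case
        unfolding Suc.IH step[of "K + n"] prod.lessThan_Suc of_nat_mult add_Suc_right mult.assoc ..
    qed simp
    moreover have "(\<Prod>j<n. prm (node v (K + j))) \<ge> n" for n
    proof -
      have "2 ^ n \<le> (\<Prod>j<n. prm (node v (K + j)))"
        using prod_mono[of "{..<n}" "\<lambda>_. 2" "\<lambda>j. prm (node v (K + j))"]
        by (simp add: prime_ge_2_nat prime_prm)
      then show ?thesis using less_exp[of n] by linarith
    qed
    ultimately show "\<exists>n\<ge>N. \<exists>u\<in>tree_group X. f (smul r (yel v K)) = of_nat n * u" for N
      using endo_closed[OF f y] by meson
  qed
  obtain K where K: "integral_at g K" using g by (auto simp: tree_group_def)
  let ?F = "{v. g (Inr v) \<noteq> 0}" and ?r = "\<lambda>v. of_nat (q v K) * g (Inr v)"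
  have r: "loc (?r v)" "?r v A \<in> \<int>" for v A
    using K loc_times[OF loc_const(1) tree_group_loc[OF g]] by (auto simp: integral_at_def of_nat_fun)
  have y: "smul (?r v) (yel v K) \<in> tree_group X" if "v \<in> ?F" for v
    using that tree_group_branch[OF g] by (intro tree_group_smul yel_in_tree_group r) auto
  note decomp = tree_group_decomp[OF g K]
  have "f g = f (bel (ipart g K) + (\<Sum>v\<in>?F. smul (?r v) (yel v K)))"
    by (rule arg_cong[OF decomp(1)])
  also have "\<dots> = f (bel (ipart g K)) + f (\<Sum>v\<in>?F. smul (?r v) (yel v K))"
    by (rule endo_add[OF f bel_in_tree_group[OF decomp(2)] tree_group_sum[OF y]])
  also have "f (\<Sum>v\<in>?F. smul (?r v) (yel v K)) = (\<Sum>v\<in>?F. f (smul (?r v) (yel v K)))"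
    by (rule endo_sum[OF f y])
  also have "\<dots> = 0"
    by (rule sum.neutral) (use yel0[OF r] tree_group_branch[OF g] in blast)
  also have "f (bel (ipart g K)) = 0" by (rule base[OF decomp(2)])
  finally show ?thesis by (simp only: add_0)
qed

text \<open>For a branch w other than v, the primes of v beyond the splitting level do not occur
  in the denominators at w.\<close>

lemma endo_yel_other_branch_0:
  assumes f: "endo X f" and v: "snd v \<in> X" and "w \<noteq> v"
    and base: "\<And>b. b \<in> base \<Longrightarrow> f (bel b) (Inr w) = 0"
  shows "f (yel v 0) (Inr w) = 0"
proof (rule ext)
  fix A
  define x where "x = f (yel v 0) (Inr w) A"
  obtain a c where quot: "quotient_of x = (a, c)" by force
  then have c: "c > 0" and x: "x = of_int a / of_int c"
    using quotient_of_denom_pos quotient_of_div by blast+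
  obtain N where N: "\<And>j. j \<ge> N \<Longrightarrow> node v j \<noteq> node w j" using branches_separate[of v w] assms(3) by blast
  have y: "yel v K \<in> tree_group X" for K by (rule yel_in_tree_group[OF v])
  \<comment> \<open>It is enough that unboundedly large primes divide the numerator a. Passing to
    the tail at level \<open>Suc j\<close> puts the prime of level j into \<open>q v K\<close>; the
    base part is invisible at w, and the denominator at w divides some \<open>q w L\<close>, which
    this prime does not divide.\<close>
  have "int (prm (node v j)) dvd a" if j: "j \<ge> N" for j
  proof -
    define K where "K = Suc j"
    define u where "u = f (yel v K)"
    have "f (yel v 0) = of_nat (q v K) * u + f (bel (part v K))"
      using endo_add[OF f tree_group_of_nat_mult[OF y] bel_in_tree_group[OF part_base]]
        endo_of_nat_mult[OF f y] yel_0[of v K] u_def by metis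
    then have xu: "x = of_nat (q v K) * u (Inr w) A" using base[OF part_base] by (simp add: x_def)
    have "u \<in> tree_group X" unfolding u_def by (rule endo_closed[OF f y])
    then obtain L where "integral_at u L" by (auto simp: tree_group_def)
    then obtain d where d: "of_nat (q w L) * u (Inr w) A = of_int d"
      unfolding integral_at_def using Ints_cases by metis
    have "of_int (int (q w L) * a) = rat_of_nat (q w L) * (x * of_int c)" using c by (simp add: x)
    also have "\<dots> = of_int (int (q v K) * d * c)" using d by (simp add: xu algebra_simps)
    finally have eq: "int (q w L) * a = int (q v K) * d * c" using of_int_eq_iff by blast
    have p: "prime (int (prm (node v j)))" using prime_prm by simp
    have "int (prm (node v j)) dvd int (q v K)" by (simp add: K_def q_Suc)
    then have "int (prm (node v j)) dvd int (q w L) * a" unfolding eq by simp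
    moreover have "\<not> prm (node v j) dvd q w L"
      using N[OF j] by (intro not_prm_dvd_q) (metis node_eq_iff)
    ultimately show ?thesis using p by (simp add: prime_dvd_mult_iff)
  qed
  moreover have "prm (node v j) \<ge> j" for j using node_ge prm_ge le_trans by blast
  ultimately have "a = 0" using int_dvd_unbounded_imp_0[of a] by (metis le_trans nat_le_linear)
  then show "f (yel v 0) (Inr w) A = 0 A" using x by (simp add: x_def)
qed

text \<open>Pigeonhole on the finitely many initial segments of length N yields two sets whose first
  difference is at least N; Y is the one that turns right there.\<close>

lemma infinite_same_initial_segment:
  assumes "infinite (S :: nat set set)"
  obtains Y Z n where "Y \<in> S" "Z \<in> S" "n \<ge> N" "Y \<inter> {..<n} = Z \<inter> {..<n}" "n \<in> Y" "n \<notin> Z"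
proof -
  have "(\<lambda>Y. Y \<inter> {..<N}) ` S \<subseteq> Pow {..<N}" by blast
  then have "finite ((\<lambda>Y. Y \<inter> {..<N}) ` S)" by (rule finite_subset) simp
  then have "\<not> inj_on (\<lambda>Y. Y \<inter> {..<N}) S" using assms finite_imageD by blast
  then obtain A B where AB: "A \<in> S" "B \<in> S" "A \<inter> {..<N} = B \<inter> {..<N}" "A \<noteq> B"
    unfolding inj_on_def by blast
  define n where "n = (LEAST n. n \<in> A \<longleftrightarrow> n \<notin> B)"
  have "\<exists>n. n \<in> A \<longleftrightarrow> n \<notin> B" using AB(4) by blast
  then have n: "n \<in> A \<longleftrightarrow> n \<notin> B" unfolding n_def by (rule LeastI_ex)
  have eq: "m \<in> A \<longleftrightarrow> m \<in> B" if "m < n" for m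
    using not_less_Least[of m "\<lambda>n. n \<in> A \<longleftrightarrow> n \<notin> B"] that unfolding n_def by blast
  have "A \<inter> {..<n} = B \<inter> {..<n}" using eq by auto
  moreover have "n \<ge> N"
  proof (rule ccontr)
    assume "\<not> n \<ge> N"
    then have "n \<in> A \<inter> {..<N} \<longleftrightarrow> n \<in> A" "n \<in> B \<inter> {..<N} \<longleftrightarrow> n \<in> B" by auto
    then show False using n AB(3) by blast
  qed
  ultimately show ?thesis using that[of A B n] that[of B A n] AB(1,2) n by metis
qed

text \<open>Up to level n the two series agree except that Y alone adds \<open>dec k\<close> at n.
  The later terms of both carry the prime of the common node at n, while \<open>dec k\<close> does
  not.\<close>

lemma yel_diff:
  assumes "Y \<inter> {..<n} = Z \<inter> {..<n}" "n \<in> Y" "n \<notin> Z"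
  shows "yel (k, Y) 0 - yel (k, Z) 0 =
    of_nat (q (k, Y) n) * (of_nat (prm (node (k, Y) n)) * (yel (k, Y) (Suc n) - yel (k, Z) (Suc n)) + bel (dec k))"
proof -
  have node: "node (k, Y) j = node (k, Z) j" if "j \<le> n" for j
  proof -
    have "{..<j} = {..<n} \<inter> {..<j}" using that by auto
    then have "Y \<inter> {..<j} = Z \<inter> {..<j}" using assms(1) by (metis Int_assoc)
    then show ?thesis by (simp add: node_eq_iff)
  qed
  \<comment> \<open>The range extends to \<open>Suc n\<close> because the node at level n depends
    only on the bits below n and is still common.\<close>
  have q: "q (k, Y) j = q (k, Z) j" if "j \<le> Suc n" for j
    unfolding q_def by (rule prod.cong) (use node that in auto)
  have Y_Z: "j \<in> Y \<longleftrightarrow> j \<in> Z" if "j < n" for j using assms(1) that by auto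
  have corr: "corr (k, Y) j = corr (k, Z) j" if "j < n" for j
    unfolding corr_def using node[of j] Y_Z[OF that] that by simp
  have part_n: "part (k, Y) n = part (k, Z) n"
    unfolding part_def by (rule sum.cong) (use q corr in auto)
  have corr_n: "corr (k, Y) n = corr (k, Z) n + dec k"
    unfolding corr_def using node[of n] assms(2,3) by simp
  have part: "part (k, Y) (Suc n) = part (k, Z) (Suc n) + of_nat (q (k, Y) n) * dec k"
    unfolding part_Suc part_n corr_n q[OF le_SucI[OF order_refl], symmetric] distrib_left add.assoc ..
  have "bel (part (k, Y) (Suc n)) = bel (part (k, Z) (Suc n)) + of_nat (q (k, Y) n) * bel (dec k)"
    unfolding part bel_add bel_of_nat_mult ..
  moreover have "yel (k, Y) 0 = of_nat (q (k, Y) (Suc n)) * yel (k, Y) (Suc n) + bel (part (k, Y) (Suc n))"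
    by (rule yel_0)
  moreover have "yel (k, Z) 0 = of_nat (q (k, Y) (Suc n)) * yel (k, Z) (Suc n) + bel (part (k, Z) (Suc n))"
    unfolding q[OF order_refl] by (rule yel_0)
  ultimately show ?thesis by (simp only: q_Suc of_nat_mult algebra_simps)
qed

text \<open>The multiplier m clears the denominator of the image of y_v at v. Both m and r still
  depend on b; \<open>endo_scalar\<close> makes the factor uniform.\<close>

lemma endo_base_scalar:
  assumes X: "uncountable X" and f: "endo X f" and b: "b \<in> base"
  obtains m :: nat and r where "m > 0" "of_nat m * f (bel b) = smul r (bel b)"
proof -
  obtain k where k: "dec k = b" using dec_surj[OF b] .
  \<comment> \<open>The branches visible in images of base elements. Outside W the hypothesis of
    \<open>endo_yel_other_branch_0\<close> holds, so there the image of y_v has no coordinate except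
    at v.\<close>
  define W where "W = (\<Union>b'\<in>base. {v. f (bel b') (Inr v) \<noteq> 0})"
  have W: "countable W"
    unfolding W_def
    by (intro countable_UN countable_base countable_finite finite_branch_support tree_group_finite[of _ X]
        endo_closed[OF f] bel_in_tree_group)
  have W0: "f (bel b') (Inr v) = 0" if "b' \<in> base" "v \<notin> W" for b' v
    using that by (auto simp: W_def)
  define Z where "Z = {Y \<in> X. (k, Y) \<notin> W}"
  have "countable {Y. (k, Y) \<in> W}"
    using countable_image[OF W, of snd] by (rule countable_subset[rotated]) force
  moreover have "X \<subseteq> Z \<union> {Y. (k, Y) \<in> W}" by (auto simp: Z_def)
  ultimately have Z: "uncountable Z" using X by (meson countable_Un countable_subset)
  have y: "yel (k, Y) K \<in> tree_group X" if "Y \<in> Z" for Y K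
    using that by (intro yel_in_tree_group) (simp add: Z_def)
  \<comment> \<open>The remainders g lie here; restricting the indices to the base and the countable
    set W makes the number of candidates countable.\<close>
  define C where "C = {g :: elt. finite {i. g i \<noteq> 0} \<and> {i. g i \<noteq> 0} \<subseteq> range Inl \<union> Inr ` W \<and> range g \<subseteq> {h. loc h}}"
  have C: "countable C"
    unfolding C_def by (intro countable_finite_support countable_loc) (simp add: W)
  have "\<exists>m r g. m > 0 \<and> loc r \<and> (\<forall>A. r A \<in> \<int>) \<and> g \<in> C \<and>
      of_nat m * f (yel (k, Y) 0) = smul r (yel (k, Y) 0) + g" if Y: "Y \<in> Z" for Y
  proof -
    define u where "u = f (yel (k, Y) 0)"
    have u: "u \<in> tree_group X" unfolding u_def by (rule endo_closed[OF f y[OF Y]])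
    obtain K where K: "integral_at u K" using u by (auto simp: tree_group_def)
    \<comment> \<open>Subtracting this multiple of y_v removes the coordinate at the branch v
      itself, the only one that could lie outside C.\<close>
    define r where "r = (\<lambda>A. of_nat (q (k, Y) K) * u (Inr (k, Y)) A)"
    have r: "loc r" unfolding r_def by (rule loc_mult[OF loc_const(1) tree_group_loc[OF u]])
    have r_int: "r A \<in> \<int>" for A using K by (simp add: r_def integral_at_def)
    define g where "g = of_nat (q (k, Y) K) * u - smul r (yel (k, Y) 0)"
    have g: "g \<in> tree_group X"
      unfolding g_def by (intro tree_group_diff tree_group_of_nat_mult tree_group_smul u y[OF Y] r r_int)
    have "g i = 0" if i: "i \<notin> range Inl \<union> Inr ` W" for i
    proof -
      obtain w where w: "i = Inr w" "w \<notin> W" using i by (cases i) auto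
      show ?thesis
      proof (cases "w = (k, Y)")
        case True
        then show ?thesis by (simp add: g_def w(1) r_def fun_eq_iff yel_Inr)
      next
        case False
        have "u (Inr w) = 0"
          unfolding u_def
          by (rule endo_yel_other_branch_0[OF f _ False]) (use Y W0[OF _ w(2)] in \<open>auto simp: Z_def\<close>)
        then show ?thesis using False by (simp add: g_def w(1) fun_eq_iff yel_Inr)
      qed
    qed
    then have "g \<in> C" using tree_group_finite[OF g] tree_group_loc[OF g] unfolding C_def by blast
    moreover have "of_nat (q (k, Y) K) * u = smul r (yel (k, Y) 0) + g" by (simp only: g_def add_diff_eq add_diff_cancel_left')
    ultimately show ?thesis using r r_int u_def q_pos(1) by metis
  qed
  then obtain m r g where mrg: "\<And>Y. Y \<in> Z \<Longrightarrow> m Y > 0 \<and> loc (r Y) \<and> (\<forall>A. r Y A \<in> \<int>) \<and> g Y \<in> C \<and>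
      of_nat (m Y) * f (yel (k, Y) 0) = smul (r Y) (yel (k, Y) 0) + g Y"
    by metis
  have "(\<lambda>Y. (m Y, r Y, g Y)) ` Z \<subseteq> UNIV \<times> {h. loc h} \<times> C" using mrg by auto
  moreover have "countable ((UNIV :: nat set) \<times> {h. loc h} \<times> C)"
    by (intro countable_SIGMA countable_loc C) auto
  ultimately obtain c where "infinite {Y \<in> Z. (m Y, r Y, g Y) = c}"
    using uncountable_infinite_fiber[OF Z] by blast
  moreover obtain m0 r0 g0 where "c = (m0, r0, g0)" by (metis prod_cases3)
  ultimately have S: "infinite {Y \<in> Z. m Y = m0 \<and> r Y = r0 \<and> g Y = g0}" (is "infinite ?S") by simp
  then have "?S \<noteq> {}" by (rule infinite_imp_nonempty)
  then obtain Y0 where "Y0 \<in> ?S" by blast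
  then have r0: "m0 > 0" "loc r0" "\<And>A. r0 A \<in> \<int>" using mrg by auto
  \<comment> \<open>h takes the same value \<open>g0\<close> on y_v for all branches selected by the
    pigeonhole, so it kills their differences.\<close>
  define h where "h = (\<lambda>x. of_nat m0 * f x - smul r0 x)"
  have h: "endo X h"
    unfolding h_def by (intro endo_minus endo_compose_of_nat f endo_smul r0)
  have h_g0: "h (yel (k, Y) 0) = g0" if "Y \<in> ?S" for Y
    using mrg[of Y] that by (simp add: h_def diff_eq_eq add.commute)
  have "h (bel b) = 0"
  proof (rule tree_group_divisible_eq_0)
    show "h (bel b) \<in> tree_group X" by (rule endo_closed[OF h bel_in_tree_group[OF b]])
  next
    fix N
    obtain Y Y' n where Y: "Y \<in> ?S" "Y' \<in> ?S" and n: "n \<ge> N"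
      and split: "Y \<inter> {..<n} = Y' \<inter> {..<n}" "n \<in> Y" "n \<notin> Y'"
      by (rule infinite_same_initial_segment[OF S])
    have YZ: "Y \<in> Z" "Y' \<in> Z" using Y by auto
    define p where "p = prm (node (k, Y) n)"
    define u where "u = yel (k, Y) (Suc n) - yel (k, Y') (Suc n)"
    have u: "u \<in> tree_group X" unfolding u_def by (intro tree_group_diff y YZ)
    have diff: "yel (k, Y) 0 - yel (k, Y') 0 = of_nat (q (k, Y) n) * (of_nat p * u + bel b)"
      using yel_diff[OF split, of k] unfolding k p_def u_def .
    have pu: "of_nat p * u \<in> tree_group X" by (rule tree_group_of_nat_mult[OF u])
    have "h (yel (k, Y) 0 - yel (k, Y') 0) = 0"
      unfolding endo_diff[OF h y[OF YZ(1)] y[OF YZ(2)]] h_g0[OF Y(1)] h_g0[OF Y(2)] by (rule diff_self)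
    then have "of_nat (q (k, Y) n) * (of_nat p * h u + h (bel b)) = 0"
      unfolding diff endo_of_nat_mult[OF h tree_group_add[OF pu bel_in_tree_group[OF b]]]
        endo_add[OF h pu bel_in_tree_group[OF b]] endo_of_nat_mult[OF h u] .
    then have "of_nat p * h u + h (bel b) = 0" by (auto simp: fun_eq_iff)
    then have "h (bel b) = - (of_nat p * h u)" by (simp only: eq_neg_iff_add_eq_0 add.commute)
    then have "h (bel b) = of_nat p * (- h u)" by (simp only: mult_minus_right)
    moreover have "p \<ge> N" using n node_ge[of n "(k, Y)"] prm_ge[of "node (k, Y) n"] unfolding p_def by linarith
    ultimately show "\<exists>n\<ge>N. \<exists>u\<in>tree_group X. h (bel b) = of_nat n * u"
      using tree_group_uminus[OF endo_closed[OF h u]] by blast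
  qed
  then have "of_nat m0 * f (bel b) = smul r0 (bel b)" by (simp only: h_def right_minus_eq)
  then show ?thesis using that r0(1) by blast
qed

text \<open>So far each b has its own factor. The sum of b and a basis vector outside its support
  also has a single factor, which forces the two factors to agree. Once f is multiplication by s on
  the base, f minus this multiplication vanishes on the base and hence everywhere.\<close>

lemma endo_scalar:
  assumes X: "uncountable X" and f: "endo X f"
  obtains s where "loc s" "\<And>A. s A \<in> \<int>" "\<And>g. g \<in> tree_group X \<Longrightarrow> f g = smul s g"
proof -
  have "\<exists>t. f (bel b) = smul t (bel b)" if b: "b \<in> base" for b
  proof -
    obtain m :: nat and r where m: "m > 0" "of_nat m * f (bel b) = smul r (bel b)"
      using endo_base_scalar[OF X f b] .
    have "f (bel b) i A = r A / of_nat m * bel b i A" for i A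
      using m(1) fun_cong[OF fun_cong[OF m(2)], of i A] by (simp add: field_simps)
    then have "f (bel b) = smul (\<lambda>A. r A / of_nat m) (bel b)" by (simp add: fun_eq_iff)
    then show ?thesis by blast
  qed
  then obtain t where t: "\<And>b. b \<in> base \<Longrightarrow> f (bel b) = smul (t b) (bel b)" by metis
  \<comment> \<open>The factor \<open>t b\<close> is undetermined at points where all coordinates of
    b vanish, so products with b are compared instead of factors.\<close>
  have scal: "f (bel b) = smul (t (unit_at n)) (bel b)" if b: "b \<in> base" and bn: "b n = 0" for b n
  proof -
    let ?c = "b + unit_at n"
    have c: "?c \<in> base" by (rule base_add[OF b unit_at_base])
    have "smul (t ?c) (bel ?c) = f (bel b + bel (unit_at n))" by (simp only: t[OF c] bel_add[symmetric])
    also have "\<dots> = smul (t b) (bel b) + smul (t (unit_at n)) (bel (unit_at n))"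
      unfolding endo_add[OF f bel_in_tree_group[OF b] bel_in_tree_group[OF unit_at_base]]
        t[OF b] t[OF unit_at_base] ..
    finally have eq: "t ?c A * (b j A + unit_at n j A) = t b A * b j A + t (unit_at n) A * unit_at n j A" for j A
      by (auto dest!: fun_cong[of _ _ "Inl j"] fun_cong[of _ _ A])
    have cn: "t ?c A = t (unit_at n) A" for A
      using eq[of A n] bn by (simp add: unit_at_def)
    have "t b A * b j A = t (unit_at n) A * b j A" for j A
      using eq[of A j] bn cn[of A] by (cases "j = n") (auto simp: unit_at_def)
    then show ?thesis unfolding t[OF b] by (intro elt_eqI) (auto simp: fun_eq_iff)
  qed
  define s where "s = t (unit_at 0)"
  have s_unit: "t (unit_at n) = s" if "n \<noteq> 0" for n
  proof -
    have "smul (t (unit_at n)) (bel (unit_at 0)) = smul s (bel (unit_at 0))"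
      using scal[OF unit_at_base, of 0 n] t[OF unit_at_base, of 0] that
      by (simp add: s_def unit_at_def zero_fun_def)
    then have "t (unit_at n) A = s A" for A
      by (auto simp: unit_at_def dest!: fun_cong[of _ _ "Inl 0"] fun_cong[of _ _ A])
    then show ?thesis by blast
  qed
  have base: "f (bel b) = smul s (bel b)" if b: "b \<in> base" for b
  proof -
    have "finite (insert 0 {n. b n \<noteq> 0})" using b by (simp add: base_def)
    then obtain n where "n \<notin> insert 0 {n. b n \<noteq> 0}" using ex_new_if_finite infinite_UNIV_nat by metis
    then show ?thesis using scal[OF b, of n] s_unit by auto
  qed
  \<comment> \<open>The factors came from a division by m. That s is integral and locally constant
    is seen from the image of a basis vector, which must lie in the base again.\<close>
  have "f (bel (unit_at 0)) \<in> tree_group X"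
    by (rule endo_closed[OF f bel_in_tree_group[OF unit_at_base]])
  moreover have "f (bel (unit_at 0)) (Inr v) = 0" for v
    by (simp add: base[OF unit_at_base] fun_eq_iff)
  ultimately obtain b where b: "b \<in> base" "f (bel (unit_at 0)) = bel b"
    using tree_group_no_branch_imp_bel by metis
  from b(2) have eq: "smul s (bel (unit_at 0)) = bel b" by (simp only: base[OF unit_at_base])
  have "s A = b 0 A" for A
    using fun_cong[OF fun_cong[OF eq], of "Inl 0" A] by (simp add: unit_at_def)
  then have "s = b 0" by blast
  then have s: "loc s" "\<And>A. s A \<in> \<int>" using base_loc[OF b(1)] base_Ints[OF b(1)] by auto
  have "f g = smul s g" if g: "g \<in> tree_group X" for g
  proof -
    have "f g - smul s g = 0"
      by (rule endo_eq_0_if_base_0[OF endo_minus[OF f endo_smul[OF s]] _ g]) (simp only: base diff_self)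
    then show ?thesis by (simp only: right_minus_eq)
  qed
  then show ?thesis using that s by blast
qed

section \<open>Direct summands and idempotents\<close>

lemma internal_direct_sum_projection:
  fixes G (structure)
  assumes G: "comm_group G" and sum: "internal_direct_sum G H K"
  obtains p where "\<And>x. x \<in> carrier G \<Longrightarrow> p x \<in> H"
    "\<And>x y. x \<in> carrier G \<Longrightarrow> y \<in> carrier G \<Longrightarrow> p (x \<otimes> y) = p x \<otimes> p y"
    "\<And>x. x \<in> H \<Longrightarrow> p x = x"
proof -
  interpret comm_group G by fact
  have H: "subgroup H G" and K: "subgroup K G" and HK: "H \<inter> K = {\<one>}" "H <#> K = carrier G"
    using sum by (auto simp: internal_direct_sum_def)
  have Hc: "x \<in> carrier G" if "x \<in> H" for x using that subgroup.mem_carrier[OF H] by blast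
  have Kc: "x \<in> carrier G" if "x \<in> K" for x using that subgroup.mem_carrier[OF K] by blast
  have "\<forall>x\<in>carrier G. \<exists>h. h \<in> H \<and> (\<exists>k\<in>K. x = h \<otimes> k)"
    using HK(2) unfolding set_mult_def by blast
  then obtain p where p: "\<And>x. x \<in> carrier G \<Longrightarrow> p x \<in> H \<and> (\<exists>k\<in>K. x = p x \<otimes> k)" by metis
  have unique: "p (h \<otimes> k) = h" if h: "h \<in> H" and k: "k \<in> K" for h k
  proof -
    have "h \<otimes> k \<in> carrier G" using h k Hc Kc by blast
    then obtain k' where p': "p (h \<otimes> k) \<in> H" "k' \<in> K" "h \<otimes> k = p (h \<otimes> k) \<otimes> k'" using p by blast
    define h' where "h' = p (h \<otimes> k)"
    have car: "h \<in> carrier G" "k \<in> carrier G" "h' \<in> carrier G" "k' \<in> carrier G"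
      using h k p' Hc Kc h'_def by auto
    have hk: "h \<otimes> k = h' \<otimes> k'" using p'(3) h'_def by simp
    have "inv h' \<otimes> h = inv h' \<otimes> (h \<otimes> k \<otimes> inv k)" using car by (simp add: m_assoc)
    also have "\<dots> = k' \<otimes> inv k" unfolding hk using car by (simp add: m_assoc[symmetric])
    finally have eq: "inv h' \<otimes> h = k' \<otimes> inv k" .
    have "inv h' \<otimes> h \<in> H" using p'(1) h h'_def subgroup.m_closed[OF H] subgroup.m_inv_closed[OF H] by simp
    moreover have "inv h' \<otimes> h \<in> K" unfolding eq using p'(2) k subgroup.m_closed[OF K] subgroup.m_inv_closed[OF K] by simp
    ultimately have "inv h' \<otimes> h = \<one>" using HK(1) by blast
    then have "h = h'" using car by (metis inv_closed inv_equality inv_inv)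
    then show ?thesis using h'_def by simp
  qed
  show ?thesis
  proof
    show "p x \<in> H" if "x \<in> carrier G" for x using p that by blast
    show "p x = x" if "x \<in> H" for x
      using unique[OF that subgroup.one_closed[OF K]] Hc[OF that] by simp
    fix x y assume xy: "x \<in> carrier G" "y \<in> carrier G"
    obtain k l where k: "k \<in> K" "x = p x \<otimes> k" and l: "l \<in> K" "y = p y \<otimes> l"
      using p xy by blast
    have px: "p x \<in> H" "p y \<in> H" using p xy by auto
    have "x \<otimes> y = (p x \<otimes> k) \<otimes> (p y \<otimes> l)" using k l by simp
    also have "\<dots> = (p x \<otimes> p y) \<otimes> (k \<otimes> l)" using px k(1) l(1) Hc Kc by (simp add: m_ac)
    finally show "p (x \<otimes> y) = p x \<otimes> p y"
      using unique[of "p x \<otimes> p y" "k \<otimes> l"] px k(1) l(1) subgroup.m_closed[OF H] subgroup.m_closed[OF K] by simp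
  qed
qed

text \<open>Conjugated by e, the projection onto H is an endomorphism of the coordinate group, hence
  multiplication by some s, and H is the set of elements fixed by s. Decomposing H then means
  splitting the idempotent s.\<close>

lemma superdecomposable_if_embedding:
  fixes G :: "'a monoid" (structure)
  assumes G: "comm_group G" and X: "uncountable X"
    and e: "bij_betw e (carrier G) (tree_group X)"
    and add: "\<And>x y. x \<in> carrier G \<Longrightarrow> y \<in> carrier G \<Longrightarrow> e (x \<otimes> y) = e x + e y"
  shows "superdecomposable G"
proof -
  interpret comm_group G by fact
  have eG: "e x \<in> tree_group X" if "x \<in> carrier G" for x using that e by (auto simp: bij_betw_def)
  have inj: "x = y" if "x \<in> carrier G" "y \<in> carrier G" "e x = e y" for x y
    using that e by (auto simp: bij_betw_def dest: inj_onD)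
  define e' where "e' = inv_into (carrier G) e"
  have e': "e' g \<in> carrier G" "e (e' g) = g" if "g \<in> tree_group X" for g
    using that e by (auto simp: bij_betw_def e'_def inv_into_into f_inv_into_f)
  have e'e: "e' (e x) = x" if "x \<in> carrier G" for x using that e by (simp add: bij_betw_def e'_def)
  have e_one: "e \<one> = 0" using add[of \<one> \<one>] by (simp only: one_closed r_one add_cancel_right_right)
  define fixed where "fixed = (\<lambda>r. {x \<in> carrier G. smul r (e x) = e x})"
  have fixed: "subgroup (fixed r) G" for r
  proof (rule subgroupI)
    show "fixed r \<noteq> {}" using e_one by (auto simp: fixed_def fun_eq_iff)
    fix x assume x: "x \<in> fixed r"
    then have xc: "x \<in> carrier G" by (simp add: fixed_def)
    have "e x + e (inv x) = 0" using add[of x "inv x"] xc e_one by (simp only: inv_closed r_inv)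
    then have "e (inv x) i A = - e x i A" for i A
      by (metis (no_types) add_eq_0_iff plus_fun_apply zero_fun_apply)
    then show "inv x \<in> fixed r" using x by (simp add: fixed_def fun_eq_iff)
    fix y assume y: "y \<in> fixed r"
    have "smul r (e x + e y) = smul r (e x) + smul r (e y)" by (simp add: fun_eq_iff distrib_left)
    then have "smul r (e (x \<otimes> y)) = e (x \<otimes> y)"
      using x y by (simp only: fixed_def mem_Collect_eq add)
    then show "x \<otimes> y \<in> fixed r" using x y by (simp add: fixed_def)
  qed (auto simp: fixed_def)
  have "decomposable (G\<lparr>carrier := H\<rparr>)" if H: "direct_summand H G" and nontriv: "H \<noteq> {\<one>}" for H
  proof -
    obtain K where K: "internal_direct_sum G H K" using H by (auto simp: direct_summand_def)
    then have Hsub: "subgroup H G" by (simp add: internal_direct_sum_def)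
    have Hc: "x \<in> carrier G" if "x \<in> H" for x using that subgroup.mem_carrier[OF Hsub] by blast
    obtain p where p: "\<And>x. x \<in> carrier G \<Longrightarrow> p x \<in> H"
      "\<And>x y. x \<in> carrier G \<Longrightarrow> y \<in> carrier G \<Longrightarrow> p (x \<otimes> y) = p x \<otimes> p y"
      "\<And>x. x \<in> H \<Longrightarrow> p x = x"
      using internal_direct_sum_projection[OF G K] by metis
    have e'_add: "e' (g + h) = e' g \<otimes> e' h" if "g \<in> tree_group X" "h \<in> tree_group X" for g h
      using that by (intro inj) (simp_all only: e' add tree_group_add m_closed)
    have pc: "p (e' g) \<in> carrier G" if "g \<in> tree_group X" for g using p(1) Hc e'(1)[OF that] by blast
    have "e (p (e' (g + h))) = e (p (e' g)) + e (p (e' h))" if g: "g \<in> tree_group X" and h: "h \<in> tree_group X" for g h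
      unfolding e'_add[OF g h] p(2)[OF e'(1)[OF g] e'(1)[OF h]] by (rule add[OF pc[OF g] pc[OF h]])
    then have "endo X (\<lambda>g. e (p (e' g)))" using eG[OF pc] by (simp add: endo_def)
    then obtain s where s: "loc s" "\<And>A. s A \<in> \<int>"
      and es: "\<And>g. g \<in> tree_group X \<Longrightarrow> e (p (e' g)) = smul s g"
      using endo_scalar[OF X] by metis
    have eps: "e (p x) = smul s (e x)" if "x \<in> carrier G" for x
      using es[OF eG[OF that]] e'e[OF that] by simp
    have H_fixed: "H = fixed s"
    proof (rule Set.set_eqI)
      fix x
      show "x \<in> H \<longleftrightarrow> x \<in> fixed s"
      proof
        assume "x \<in> H"
        then show "x \<in> fixed s" using eps[of x] p(3)[of x] Hc by (simp add: fixed_def)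
      next
        assume "x \<in> fixed s"
        then have x: "x \<in> carrier G" "smul s (e x) = e x" by (auto simp: fixed_def)
        then have "p x = x" using inj[of "p x" x] eps[of x] p(1) Hc by simp
        then show "x \<in> H" using p(1)[OF x(1)] by simp
      qed
    qed
    \<comment> \<open>A basis vector has a coordinate that is constantly 1, so identities between
      scalars can be read off from it.\<close>
    define x0 where "x0 = e' (bel (unit_at 0))"
    have x0: "x0 \<in> carrier G" "e x0 = bel (unit_at 0)"
      using e'[OF bel_in_tree_group[OF unit_at_base]] by (auto simp: x0_def)
    have "p (p x0) = p x0" using p x0 by simp
    then have "smul s (smul s (bel (unit_at 0))) = smul s (bel (unit_at 0))"
      using eps[OF x0(1)] eps[of "p x0"] p(1)[OF x0(1)] Hc x0(2) by simp
    then have idem: "s A * s A = s A" for A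
      by (auto simp: unit_at_def dest!: fun_cong[of _ _ "Inl 0"] fun_cong[of _ _ A])
    have "\<exists>A. s A \<noteq> 0"
    proof (rule ccontr)
      assume "\<nexists>A. s A \<noteq> 0"
      then have "e x = 0" if "x \<in> H" for x using that unfolding H_fixed by (auto simp: fixed_def fun_eq_iff)
      then have "x = \<one>" if "x \<in> H" for x using that inj[of x \<one>] Hc e_one by simp
      then show False using nontriv subgroup.one_closed[OF Hsub] by blast
    qed
    then obtain A0 where "s A0 \<noteq> 0" by blast
    then have A0: "s A0 = 1" using idem[of A0] by simp
    \<comment> \<open>s does not read the bit n. Cutting s by membership of n gives orthogonal
      idempotents with sum s, and both are nonzero: A0 truncated below n, with or without n added,
      still has s = 1.\<close>
    obtain n where n: "\<forall>A. s A = s (A \<inter> {..<n})" using s(1) unfolding loc_def by blast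
    define s1 where "s1 = (\<lambda>A. s A * (if n \<in> A then 1 else 0))"
    define s2 where "s2 = (\<lambda>A. s A * (if n \<in> A then 0 else 1))"
    have loc12: "loc s1" "loc s2"
      unfolding s1_def s2_def by (intro loc_mult s(1) loc_member)+
    have int12: "s1 A \<in> \<int>" "s2 A \<in> \<int>" for A using s(2) by (auto simp: s1_def s2_def)
    have idem12: "s A * s1 A = s1 A" "s A * s2 A = s2 A" "s1 A * s1 A = s1 A" "s2 A * s2 A = s2 A"
      "s1 A * s2 A = 0" "s1 A + s2 A = s A" for A
      using idem[of A] by (auto simp: s1_def s2_def)
    have sub: "fixed r \<subseteq> H" if "\<And>A. s A * r A = r A" for r
    proof
      fix x assume x: "x \<in> fixed r"
      then have "r A * e x i A = e x i A" for i A
        by (auto simp: fixed_def dest!: fun_cong[of _ _ i] fun_cong[of _ _ A])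
      then have "s A * e x i A = e x i A" for i A using that[of A] by (metis mult.assoc)
      then show "x \<in> H" using x unfolding H_fixed by (simp add: fixed_def fun_eq_iff)
    qed
    have image: "e' (smul r g) \<in> fixed r" "e (e' (smul r g)) = smul r g"
      if "g \<in> tree_group X" "loc r" "\<And>A. r A \<in> \<int>" "\<And>A. r A * r A = r A" for r g
    proof -
      have rg: "smul r g \<in> tree_group X" by (rule tree_group_smul[OF that(1-3)])
      show "e (e' (smul r g)) = smul r g" by (rule e'(2)[OF rg])
      moreover have "smul r (smul r g) = smul r g" using that(4) by (simp add: fun_eq_iff mult.assoc[symmetric])
      ultimately show "e' (smul r g) \<in> fixed r" using e'[OF rg] unfolding fixed_def by simp
    qed
    have nontriv_fixed: "fixed r \<noteq> {\<one>}"
      if r: "loc r" "\<And>A. r A \<in> \<int>" "\<And>A. r A * r A = r A" and "r A = 1" for r A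
    proof
      assume "fixed r = {\<one>}"
      then have "e' (smul r (bel (unit_at 0))) = \<one>"
        using image(1)[OF bel_in_tree_group[OF unit_at_base] r] by blast
      then have "smul r (bel (unit_at 0)) = 0"
        using image(2)[OF bel_in_tree_group[OF unit_at_base] r] e_one by metis
      then have "smul r (bel (unit_at 0)) (Inl 0) A = 0" by simp
      then show False using \<open>r A = 1\<close> by (simp add: unit_at_def)
    qed
    have "internal_direct_sum (G\<lparr>carrier := H\<rparr>) (fixed s1) (fixed s2)"
      unfolding internal_direct_sum_def
    proof (intro conjI)
      show "subgroup (fixed s1) (G\<lparr>carrier := H\<rparr>)" "subgroup (fixed s2) (G\<lparr>carrier := H\<rparr>)"
        using sub idem12 by (intro subgroup_incl fixed Hsub; blast)+
      show "fixed s1 \<inter> fixed s2 = {\<one>\<^bsub>G\<lparr>carrier := H\<rparr>\<^esub>}"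
      proof
        show "fixed s1 \<inter> fixed s2 \<subseteq> {\<one>\<^bsub>G\<lparr>carrier := H\<rparr>\<^esub>}"
        proof
          fix x assume x: "x \<in> fixed s1 \<inter> fixed s2"
          then have xc: "x \<in> carrier G" and 1: "smul s1 (e x) = e x" and 2: "smul s2 (e x) = e x"
            by (auto simp: fixed_def)
          have "e x i A = 0" for i A
          proof -
            have "e x i A = s1 A * e x i A" "e x i A = s2 A * e x i A"
              using fun_cong[OF fun_cong[OF 1], of i A] fun_cong[OF fun_cong[OF 2], of i A] by simp_all
            then have "e x i A = (s1 A * s2 A) * e x i A" by (metis mult.assoc)
            then show ?thesis by (simp add: idem12)
          qed
          then have "e x = e \<one>" unfolding e_one by (simp add: fun_eq_iff)
          then show "x \<in> {\<one>\<^bsub>G\<lparr>carrier := H\<rparr>\<^esub>}" using inj[OF xc one_closed] by simp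
        qed
        show "{\<one>\<^bsub>G\<lparr>carrier := H\<rparr>\<^esub>} \<subseteq> fixed s1 \<inter> fixed s2"
          using subgroup.one_closed[OF fixed] by simp
      qed
      show "fixed s1 <#>\<^bsub>G\<lparr>carrier := H\<rparr>\<^esub> fixed s2 = carrier (G\<lparr>carrier := H\<rparr>)"
      proof
        show "fixed s1 <#>\<^bsub>G\<lparr>carrier := H\<rparr>\<^esub> fixed s2 \<subseteq> carrier (G\<lparr>carrier := H\<rparr>)"
          using subsetD[OF sub[OF idem12(1)]] subsetD[OF sub[OF idem12(2)]] subgroup.m_closed[OF Hsub]
          by (auto simp: set_mult_def)
        show "carrier (G\<lparr>carrier := H\<rparr>) \<subseteq> fixed s1 <#>\<^bsub>G\<lparr>carrier := H\<rparr>\<^esub> fixed s2"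
        proof
          fix x assume "x \<in> carrier (G\<lparr>carrier := H\<rparr>)"
          then have x: "x \<in> H" by simp
          define x1 where "x1 = e' (smul s1 (e x))"
          define x2 where "x2 = e' (smul s2 (e x))"
          have x1: "x1 \<in> fixed s1" "e x1 = smul s1 (e x)"
            unfolding x1_def by (intro image eG Hc x loc12 int12 idem12)+
          have x2: "x2 \<in> fixed s2" "e x2 = smul s2 (e x)"
            unfolding x2_def by (intro image eG Hc x loc12 int12 idem12)+
          have c12: "x1 \<in> carrier G" "x2 \<in> carrier G" using x1 x2 by (auto simp: fixed_def)
          have "smul s1 (e x) + smul s2 (e x) = smul s (e x)"
            using idem12(6) by (simp add: fun_eq_iff distrib_right[symmetric])
          also have "\<dots> = e x" using x unfolding H_fixed by (simp add: fixed_def)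
          finally have "e (x1 \<otimes> x2) = e x" unfolding add[OF c12] x1 x2 .
          then have "x = x1 \<otimes> x2" using inj[of "x1 \<otimes> x2" x] c12 Hc[OF x] by simp
          then show "x \<in> fixed s1 <#>\<^bsub>G\<lparr>carrier := H\<rparr>\<^esub> fixed s2"
            using x1(1) x2(1) by (auto simp: set_mult_def)
        qed
      qed
    qed
    moreover have "fixed s1 \<noteq> {\<one>}"
    proof (rule nontriv_fixed[OF loc12(1) int12(1) idem12(3)])
      have "insert n (A0 \<inter> {..<n}) \<inter> {..<n} = A0 \<inter> {..<n}" by auto
      then have "s (insert n (A0 \<inter> {..<n})) = s A0" using n by metis
      then show "s1 (insert n (A0 \<inter> {..<n})) = 1" by (simp add: s1_def A0)
    qed
    moreover have "fixed s2 \<noteq> {\<one>}"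
    proof (rule nontriv_fixed[OF loc12(2) int12(2) idem12(4)])
      have "s (A0 \<inter> {..<n}) = s A0" using n by metis
      then show "s2 (A0 \<inter> {..<n}) = 1" by (simp add: s2_def A0)
    qed
    ultimately show ?thesis unfolding decomposable_def by auto
  qed
  then show ?thesis using G by (simp add: superdecomposable_def)
qed

section \<open>Countable subgroups, cardinality and the final carrier\<close>

lemma aleph1_free_if_embedding:
  fixes G :: "'a monoid" (structure)
  assumes G: "comm_group G" and e: "bij_betw e (carrier G) (tree_group X)"
    and add: "\<And>x y. x \<in> carrier G \<Longrightarrow> y \<in> carrier G \<Longrightarrow> e (x \<otimes> y) = e x + e y"
  shows "aleph1_free G"
proof -
  interpret comm_group G by fact
  have "free_abelian (G\<lparr>carrier := H\<rparr>)" if H: "subgroup H G" "countable H" for H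
  proof -
    have Hc: "H \<subseteq> carrier G" by (rule subgroup.subset[OF H(1)])
    have "group (G\<lparr>carrier := H\<rparr>)" by (rule subgroup_imp_group[OF H(1)])
    then have "comm_group (G\<lparr>carrier := H\<rparr>)"
      by (rule group.group_comm_groupI) (use Hc m_comm in auto)
    moreover have "inj_on e H" using e Hc unfolding bij_betw_def by (blast intro: inj_on_subset)
    moreover have "e ` H \<subseteq> tree_group X" using e Hc unfolding bij_betw_def by blast
    moreover have "e (x \<otimes> y) = e x + e y" if "x \<in> H" "y \<in> H" for x y
      using that Hc by (intro add) auto
    ultimately show ?thesis
      using H(2) by (intro free_abelian_if_countable_embedding[where e = e and X = X]) simp_all
  qed
  then show ?thesis using G by (simp add: aleph1_free_def)
qed

text \<open>From above, an element is a finite set of pairs of an index and a locally constant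
  function, of which there are at most as many as elements of X; from below, distinct branches of
  the tree 0 give distinct elements y_v.\<close>

lemma card_tree_group:
  assumes X: "infinite X"
  shows "|tree_group X| =o |X|"
proof -
  have card_countable: "|C| \<le>o |X|" if "countable C" for C :: "'b set"
  proof -
    obtain f :: "'b \<Rightarrow> nat" where "inj_on f C" using \<open>countable C\<close> unfolding countable_def by blast
    then have "|C| \<le>o |UNIV :: nat set|" by (rule card_of_ordLeqI) simp
    moreover have "|UNIV :: nat set| \<le>o |X|" using X by (simp add: infinite_iff_card_of_nat)
    ultimately show ?thesis by (rule ordLeq_transitive)
  qed
  let ?J = "range Inl \<union> Inr ` (UNIV \<times> X) :: (nat + branch) set"
  let ?L = "{f :: nat set \<Rightarrow> rat. loc f}"
  have fieldX: "infinite (Field |X| )" using X by (simp add: Field_card_of)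
  have "|(UNIV :: nat set) \<times> X| \<le>o |X|"
    by (rule card_of_Times_ordLeq_infinite_Field[OF fieldX card_countable])
       (simp_all add: card_of_Card_order)
  then have "|Inr ` ((UNIV :: nat set) \<times> X) :: (nat + branch) set| \<le>o |X|"
    by (rule ordLeq_transitive[OF card_of_image])
  moreover have "|range Inl :: (nat + branch) set| \<le>o |X|" by (rule card_countable) simp
  ultimately have "|?J| \<le>o |X|"
    by (intro card_of_Un_ordLeq_infinite_Field[OF fieldX _ _ card_of_Card_order])
  then have JL: "|?J \<times> ?L| \<le>o |X|"
    by (rule card_of_Times_ordLeq_infinite_Field[OF fieldX _ card_countable[OF countable_loc] card_of_Card_order])
  have "infinite ?J" using range_inj_infinite[of "Inl :: nat \<Rightarrow> nat + branch"] by simp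
  moreover have "?L \<noteq> {}" using loc_const(2) by blast
  ultimately have "infinite (?J \<times> ?L)" using finite_cartesian_productD1[of ?J ?L] by blast
  then have "|Fpow (?J \<times> ?L)| =o |?J \<times> ?L|" by (rule card_of_Fpow_infinite)
  then have Fpow: "|Fpow (?J \<times> ?L)| \<le>o |X|" using JL by (rule ordIso_ordLeq_trans)
  have "|tree_group X| \<le>o |Fpow (?J \<times> ?L)|"
  proof (rule card_of_ordLeqI[OF inj_on_subset[OF inj_on_graph_image subset_UNIV]])
    fix g assume g: "g \<in> tree_group X"
    have "i \<in> ?J" if "g i \<noteq> 0" for i
    proof (cases i)
      case (Inr v)
      then have "v \<in> UNIV \<times> X" using tree_group_branch[OF g] that by (simp add: mem_Times_iff)
      then show ?thesis using Inr by blast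
    qed simp
    then show "(\<lambda>i. (i, g i)) ` {i. g i \<noteq> 0} \<in> Fpow (?J \<times> ?L)"
      using tree_group_finite[OF g] tree_group_loc[OF g] by (auto simp: Fpow_def)
  qed
  then have upper: "|tree_group X| \<le>o |X|" using Fpow by (rule ordLeq_transitive)
  have "|X| \<le>o |tree_group X|"
  proof (rule card_of_ordLeqI)
    show "inj_on (\<lambda>Y. yel (0, Y) 0) X"
    proof (rule inj_onI)
    fix Y Z assume "yel (0, Y) 0 = yel (0, Z) 0"
    then have "yel (0, Y) 0 (Inr (0, Z)) \<noteq> 0" by (simp add: yel_Inr_neq_0)
    then show "Y = Z" by (simp add: yel_Inr_neq_0)
    qed
    show "yel (0, Y) 0 \<in> tree_group X" if "Y \<in> X" for Y
      using that by (intro yel_in_tree_group) simp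
  qed
  then show ?thesis using upper by (simp add: ordIso_iff_ordLeq)
qed

text \<open>Cantor's theorem and the minimality of the successor cardinal place aleph_1 below the
  continuum, whatever the size of the latter.\<close>

lemma exists_aleph1_subset:
  obtains X :: "nat set set" where "|X| =o cardSuc natLeq" "uncountable X"
proof -
  have cs: "Card_order (cardSuc natLeq)" by (rule cardSuc_Card_order[OF natLeq_Card_order])
  have nat: "natLeq =o |UNIV :: nat set|" by (rule ordIso_symmetric[OF card_of_nat])
  have "natLeq <o |UNIV :: nat set set|"
    using ordIso_ordLess_trans[OF nat card_of_Pow] by simp
  then have "cardSuc natLeq \<le>o |UNIV :: nat set set|"
    by (rule cardSuc_least[OF natLeq_Card_order card_of_Card_order])
  then have "|Field (cardSuc natLeq)| \<le>o |UNIV :: nat set set|"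
    by (rule ordIso_ordLeq_trans[OF card_of_Field_ordIso[OF cs]])
  then obtain X :: "nat set set" where "|Field (cardSuc natLeq)| =o |X|"
    by (meson internalize_card_of_ordLeq2[THEN iffD1])
  then have X: "|X| =o cardSuc natLeq"
    by (rule ordIso_transitive[OF ordIso_symmetric card_of_Field_ordIso[OF cs]])
  have "uncountable X"
  proof
    assume "countable X"
    then obtain f :: "nat set \<Rightarrow> nat" where "inj_on f X" unfolding countable_def by blast
    then have "|X| \<le>o |UNIV :: nat set|" by (rule card_of_ordLeqI) simp
    then have "cardSuc natLeq \<le>o natLeq"
      by (rule ordIso_ordLeq_trans[OF ordIso_symmetric[OF X] ordLeq_ordIso_trans[OF _ card_of_nat]])
    then show False using cardSuc_greater[OF natLeq_Card_order] not_ordLess_ordLeq by blast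
  qed
  with X show ?thesis by (rule that)
qed

text \<open>Transport of structure along i, from pointwise addition of functions to a multiplicative
  group record on the target type.\<close>

lemma tree_group_copy:
  fixes i :: "elt \<Rightarrow> 'a"
  assumes i: "inj_on i (tree_group X)"
  defines "e \<equiv> inv_into (tree_group X) i"
  defines "G \<equiv> \<lparr>carrier = i ` tree_group X, monoid.mult = (\<lambda>x y. i (e x + e y)), one = i 0\<rparr>"
  shows "comm_group G" and "bij_betw e (carrier G) (tree_group X)"
    and "\<And>x y. x \<in> carrier G \<Longrightarrow> y \<in> carrier G \<Longrightarrow> e (x \<otimes>\<^bsub>G\<^esub> y) = e x + e y"
proof -
  have ei: "e (i g) = g" if "g \<in> tree_group X" for g using i that by (simp add: e_def)
  show "bij_betw e (carrier G) (tree_group X)"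
    unfolding G_def e_def using i by (simp add: bij_betw_inv_into inj_on_imp_bij_betw)
  show "e (x \<otimes>\<^bsub>G\<^esub> y) = e x + e y" if "x \<in> carrier G" "y \<in> carrier G" for x y
    using that by (auto simp: G_def ei tree_group_add)
  show "comm_group G"
  proof (rule comm_groupI)
    fix x assume "x \<in> carrier G"
    then obtain g where g: "g \<in> tree_group X" "x = i g" by (auto simp: G_def)
    have "i (- g) \<otimes>\<^bsub>G\<^esub> x = \<one>\<^bsub>G\<^esub>"
      using g by (simp only: G_def monoid.simps ei tree_group_uminus ab_left_minus)
    moreover have "i (- g) \<in> carrier G" using g by (simp add: G_def tree_group_uminus)
    ultimately show "\<exists>y\<in>carrier G. y \<otimes>\<^bsub>G\<^esub> x = \<one>\<^bsub>G\<^esub>" by blast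
  next
    fix x y z assume "x \<in> carrier G" "y \<in> carrier G" "z \<in> carrier G"
    then obtain g h k where "g \<in> tree_group X" "x = i g" "h \<in> tree_group X" "y = i h"
      "k \<in> tree_group X" "z = i k" by (auto simp: G_def)
    then show "x \<otimes>\<^bsub>G\<^esub> y \<otimes>\<^bsub>G\<^esub> z = x \<otimes>\<^bsub>G\<^esub> (y \<otimes>\<^bsub>G\<^esub> z)"
      by (simp only: G_def monoid.simps ei tree_group_add add.assoc)
  next
    fix x y assume "x \<in> carrier G" "y \<in> carrier G"
    then show "x \<otimes>\<^bsub>G\<^esub> y = y \<otimes>\<^bsub>G\<^esub> x" by (simp only: G_def monoid.simps add.commute)
  next
    fix x y assume "x \<in> carrier G" "y \<in> carrier G"
    then show "x \<otimes>\<^bsub>G\<^esub> y \<in> carrier G" by (auto simp: G_def ei tree_group_add)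
  next
    show "\<one>\<^bsub>G\<^esub> \<in> carrier G" by (simp add: G_def tree_group_0)
  next
    fix x assume "x \<in> carrier G"
    then obtain g where "g \<in> tree_group X" "x = i g" by (auto simp: G_def)
    then show "\<one>\<^bsub>G\<^esub> \<otimes>\<^bsub>G\<^esub> x = x" by (simp only: G_def monoid.simps ei tree_group_0 add_0)
  qed
qed

(* The carrier type nat set has cardinality 2 ^ aleph_0, so it contains an isomorphic copy of
   every group of cardinality aleph_1; the latter is cardSuc natLeq, the successor of aleph_0. *)
theorem mainTheorem3:
  shows "\<exists>G :: (nat set) monoid.
    comm_group G \<and> aleph1_free G \<and> superdecomposable G \<and> |carrier G| =o cardSuc natLeq"
proof -
  obtain X :: "nat set set" where X: "|X| =o cardSuc natLeq" "uncountable X"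
    by (rule exists_aleph1_subset)
  have card: "|tree_group X| =o |X|"
    by (rule card_tree_group) (use X(2) countable_finite in blast)
  have "|X| \<le>o |UNIV :: nat set set|" by (rule card_of_mono1) simp
  then have "|tree_group X| \<le>o |UNIV :: nat set set|" by (rule ordIso_ordLeq_trans[OF card])
  then obtain i :: "elt \<Rightarrow> nat set" where i: "inj_on i (tree_group X)"
    using card_of_ordLeq[THEN iffD2] by blast
  let ?e = "inv_into (tree_group X) i"
  let ?G = "\<lparr>carrier = i ` tree_group X, monoid.mult = (\<lambda>x y. i (?e x + ?e y)), one = i 0\<rparr>"
  note copy = tree_group_copy[OF i]
  have "|tree_group X| =o |carrier ?G|"
    by (rule card_of_ordIsoI[of i]) (simp add: inj_on_imp_bij_betw[OF i])
  then have "|carrier ?G| =o cardSuc natLeq"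
    by (rule ordIso_transitive[OF ordIso_symmetric ordIso_transitive[OF card X(1)]])
  moreover have "aleph1_free ?G" by (rule aleph1_free_if_embedding[OF copy])
  moreover have "superdecomposable ?G" by (rule superdecomposable_if_embedding[OF copy(1) X(2) copy(2,3)])
  ultimately show ?thesis using copy(1) by blast
qed

end
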